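(* Let $M$ be a compact connected closed orientable $C^\infty$-smooth Riemannian manifold of dimension $2$ with $H^1(M)=0$. Let $\lambda\neq 0$ and $u\in E_\lambda$, and suppose that zero is not a critical value for $u$. Then for each $v\in E_\lambda$ every connected component of $N_u$ contains at least two points of $N_v$.
   Context: All functions are real valued. $\Delta$ is the Laplace--Beltrami operator on $M$, with the sign such that it is the ordinary Laplacian in the Euclidean case; $E_\lambda=\{u\in C^2(M):\ \Delta u+\lambda u=0\}$. For $u\in E_\lambda$, $N_u=\{x\in M:\ u(x)=0\}$ is the nodal set of $u$. $H^1(M)$ is the first de Rham cohomology. Zero is a critical value of $u$ if there is $x\in M$ with $u(x)=0$ and $du(x)=0$. *)

theory Defs
  imports "HOL-Analysis.Analysis"
begin

section \<open>Functions of class C^k on open subsets of Euclidean space\<close>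

text \<open>Meant for open \<open>S\<close> only: the derivatives are unrestricted Frechet derivatives.\<close>

primrec Ck_on :: "nat \<Rightarrow> ('a::euclidean_space \<Rightarrow> 'b::real_normed_vector) \<Rightarrow> 'a set \<Rightarrow> bool"
  where
    "Ck_on 0 f S \<longleftrightarrow> continuous_on S f"
  | "Ck_on (Suc k) f S \<longleftrightarrow>
       (\<forall>x\<in>S. f differentiable (at x)) \<and>
       (\<forall>b\<in>Basis. Ck_on k (\<lambda>x. frechet_derivative f (at x) b) S)"

definition smooth_on :: "('a::euclidean_space \<Rightarrow> 'b::real_normed_vector) \<Rightarrow> 'a set \<Rightarrow> bool"
  where "smooth_on f S \<longleftrightarrow> (\<forall>k. Ck_on k f S)"

definition partial_deriv :: "'n::finite \<Rightarrow> (real^'n \<Rightarrow> real) \<Rightarrow> real^'n \<Rightarrow> real"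
  where "partial_deriv i f x = frechet_derivative f (at x) (axis i 1)"


section \<open>Smooth manifolds\<close>

text \<open>A chart is a pair of a domain and a coordinate map; the values of the map outside
  the domain are irrelevant. All charts take values in open subsets of \<open>real^'n\<close>, so
  the manifolds have no boundary and dimension \<open>CARD('n)\<close>.\<close>

type_synonym ('a, 'n) chart = "'a set \<times> ('a \<Rightarrow> real^'n)"

abbreviation chart_dom :: "('a, 'n::finite) chart \<Rightarrow> 'a set"
  where "chart_dom c \<equiv> fst c"

abbreviation chart_map :: "('a, 'n::finite) chart \<Rightarrow> 'a \<Rightarrow> real^'n"
  where "chart_map c \<equiv> snd c"

definition chart_img :: "('a, 'n::finite) chart \<Rightarrow> (real^'n) set"
  where "chart_img c = chart_map c ` chart_dom c"

definition chart_inv :: "('a, 'n::finite) chart \<Rightarrow> real^'n \<Rightarrow> 'a"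
  where "chart_inv c = inv_into (chart_dom c) (chart_map c)"

definition is_chart :: "'a topology \<Rightarrow> ('a, 'n::finite) chart \<Rightarrow> bool"
  where "is_chart M c \<longleftrightarrow>
     openin M (chart_dom c) \<and> open (chart_img c) \<and>
     homeomorphic_map (subtopology M (chart_dom c)) (top_of_set (chart_img c)) (chart_map c)"

definition in_coords :: "('a, 'n::finite) chart \<Rightarrow> ('a \<Rightarrow> 'b) \<Rightarrow> real^'n \<Rightarrow> 'b"
  where "in_coords c f = f \<circ> chart_inv c"

definition transition :: "('a, 'n::finite) chart \<Rightarrow> ('a, 'n) chart \<Rightarrow> real^'n \<Rightarrow> real^'n"
  where "transition c c' = chart_map c' \<circ> chart_inv c"

definition transition_jacobian :: "('a, 'n::finite) chart \<Rightarrow> ('a, 'n) chart \<Rightarrow> 'a \<Rightarrow> real^'n^'n"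
  where "transition_jacobian c c' p = jacobian (transition c c') (at (chart_map c p))"

definition smooth_atlas :: "'a topology \<Rightarrow> ('a, 'n::finite) chart set \<Rightarrow> bool"
  where "smooth_atlas M A \<longleftrightarrow>
     (\<forall>c\<in>A. is_chart M c) \<and>
     (\<Union>c\<in>A. chart_dom c) = topspace M \<and>
     (\<forall>c\<in>A. \<forall>c'\<in>A. smooth_on (transition c c') (chart_map c ` (chart_dom c \<inter> chart_dom c')))"

text \<open>The atlas need not be maximal; it determines the smooth structure.\<close>

definition smooth_manifold :: "'a topology \<Rightarrow> ('a, 'n::finite) chart set \<Rightarrow> bool"
  where "smooth_manifold M A \<longleftrightarrow>
     Hausdorff_space M \<and> second_countable M \<and> smooth_atlas M A"

text \<open>The charts of the oriented atlas \<open>B\<close> are arbitrary charts of the smooth structure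
  given by \<open>A\<close>, not necessarily members of \<open>A\<close>.\<close>

definition orientable :: "'a topology \<Rightarrow> ('a, 'n::finite) chart set \<Rightarrow> bool"
  where "orientable M A \<longleftrightarrow>
     (\<exists>B. smooth_atlas M B \<and> smooth_atlas M (A \<union> B) \<and>
       (\<forall>c\<in>B. \<forall>c'\<in>B. \<forall>p\<in>chart_dom c \<inter> chart_dom c'. det (transition_jacobian c c' p) > 0))"

definition Ck_function :: "nat \<Rightarrow> ('a, 'n::finite) chart set \<Rightarrow> ('a \<Rightarrow> real) \<Rightarrow> bool"
  where "Ck_function k A f \<longleftrightarrow> (\<forall>c\<in>A. Ck_on k (in_coords c f) (chart_img c))"

definition smooth_function :: "('a, 'n::finite) chart set \<Rightarrow> ('a \<Rightarrow> real) \<Rightarrow> bool"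
  where "smooth_function A f \<longleftrightarrow> (\<forall>c\<in>A. smooth_on (in_coords c f) (chart_img c))"


section \<open>Differential forms of degree 1 and the first de Rham cohomology\<close>

text \<open>Tensor fields are given by their components: \<open>\<omega> c p\<close> is the coefficient vector,
  in the chart \<open>c\<close>, of the covector at \<open>p\<close>. Values for \<open>c\<close> outside the atlas or \<open>p\<close>
  outside the chart domain are irrelevant, so an equation between forms is only asked
  for at points of chart domains.\<close>

type_synonym ('a, 'n) covector_field = "('a, 'n) chart \<Rightarrow> 'a \<Rightarrow> real^'n"

definition one_forms :: "('a, 'n::finite) chart set \<Rightarrow> ('a, 'n) covector_field set"
  where "one_forms A = {\<omega>.
     (\<forall>c\<in>A. smooth_on (in_coords c (\<omega> c)) (chart_img c)) \<and>
     (\<forall>c\<in>A. \<forall>c'\<in>A. \<forall>p\<in>chart_dom c \<inter> chart_dom c'.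
        \<omega> c p = transpose (transition_jacobian c c' p) *v \<omega> c' p)}"

definition differential :: "('a \<Rightarrow> real) \<Rightarrow> ('a, 'n::finite) covector_field"
  where "differential f c p = (\<chi> i. partial_deriv i (in_coords c f) (chart_map c p))"

text \<open>The coefficients of \<open>d\<omega>\<close>, which is the sum over \<open>i < j\<close> of
  \<open>exterior_deriv \<omega> c p $ i $ j\<close> times \<open>dx_i \<and> dx_j\<close>.\<close>

definition exterior_deriv ::
    "('a, 'n::finite) covector_field \<Rightarrow> ('a, 'n) chart \<Rightarrow> 'a \<Rightarrow> real^'n^'n"
  where "exterior_deriv \<omega> c p = (\<chi> i j.
     partial_deriv i (in_coords c (\<lambda>q. \<omega> c q $ j)) (chart_map c p) -
     partial_deriv j (in_coords c (\<lambda>q. \<omega> c q $ i)) (chart_map c p))"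

definition closed_one_forms :: "('a, 'n::finite) chart set \<Rightarrow> ('a, 'n) covector_field set"
  where "closed_one_forms A =
     {\<omega> \<in> one_forms A. \<forall>c\<in>A. \<forall>p\<in>chart_dom c. exterior_deriv \<omega> c p = 0}"

definition exact_one_forms :: "('a, 'n::finite) chart set \<Rightarrow> ('a, 'n) covector_field set"
  where "exact_one_forms A =
     {\<omega> \<in> one_forms A. \<exists>f. smooth_function A f \<and>
        (\<forall>c\<in>A. \<forall>p\<in>chart_dom c. \<omega> c p = differential f c p)}"

definition cohomologous ::
    "('a, 'n::finite) chart set \<Rightarrow> (('a, 'n) covector_field \<times> ('a, 'n) covector_field) set"
  where "cohomologous A = {(\<omega>, \<eta>). \<omega> \<in> closed_one_forms A \<and> \<eta> \<in> closed_one_forms A \<and>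
     (\<lambda>c p. \<omega> c p - \<eta> c p) \<in> exact_one_forms A}"

definition de_Rham_H1 :: "('a, 'n::finite) chart set \<Rightarrow> ('a, 'n) covector_field set set"
  where "de_Rham_H1 A = closed_one_forms A // cohomologous A"

text \<open>The zero class of the quotient is the set of exact forms.\<close>

definition H1_vanishes :: "('a, 'n::finite) chart set \<Rightarrow> bool"
  where "H1_vanishes A \<longleftrightarrow> de_Rham_H1 A = {exact_one_forms A}"


section \<open>Riemannian metrics and the Laplace-Beltrami operator\<close>

type_synonym ('a, 'n) metric = "('a, 'n) chart \<Rightarrow> 'a \<Rightarrow> real^'n^'n"

definition riemannian_metric :: "('a, 'n::finite) chart set \<Rightarrow> ('a, 'n) metric \<Rightarrow> bool"
  where "riemannian_metric A g \<longleftrightarrow>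
     (\<forall>c\<in>A. smooth_on (in_coords c (g c)) (chart_img c)) \<and>
     (\<forall>c\<in>A. \<forall>p\<in>chart_dom c. transpose (g c p) = g c p \<and>
        (\<forall>\<xi>. \<xi> \<noteq> 0 \<longrightarrow> \<xi> \<bullet> (g c p *v \<xi>) > 0)) \<and>
     (\<forall>c\<in>A. \<forall>c'\<in>A. \<forall>p\<in>chart_dom c \<inter> chart_dom c'.
        g c p = transpose (transition_jacobian c c' p) ** g c' p ** transition_jacobian c c' p)"

text \<open>In local coordinates, \<open>\<Delta>u\<close> is
  \<open>1 / sqrt |g|\<close> times the sum over \<open>i\<close>, \<open>j\<close> of
  \<open>\<partial>_i (sqrt |g| g^{ij} \<partial>_j u)\<close>. The value at \<open>p\<close> does not depend on the chart around
  \<open>p\<close>, so \<open>\<Delta>u\<close> is a function on the manifold.\<close>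

definition laplace_beltrami ::
    "('a, 'n::finite) metric \<Rightarrow> ('a, 'n) chart \<Rightarrow> ('a \<Rightarrow> real) \<Rightarrow> 'a \<Rightarrow> real"
  where "laplace_beltrami g c u p =
     (\<Sum>i\<in>UNIV. partial_deriv i
        (\<lambda>x. sqrt (det (in_coords c (g c) x)) *
           (\<Sum>j\<in>UNIV. matrix_inv (in_coords c (g c) x) $ i $ j * partial_deriv j (in_coords c u) x))
        (chart_map c p)) / sqrt (det (g c p))"

definition eigenspace ::
    "('a, 'n::finite) chart set \<Rightarrow> ('a, 'n) metric \<Rightarrow> real \<Rightarrow> ('a \<Rightarrow> real) set"
  where "eigenspace A g lam = {u. Ck_function 2 A u \<and>
     (\<forall>c\<in>A. \<forall>p\<in>chart_dom c. laplace_beltrami g c u p + lam * u p = 0)}"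

definition nodal_set :: "'a topology \<Rightarrow> ('a \<Rightarrow> real) \<Rightarrow> 'a set"
  where "nodal_set M u = {x \<in> topspace M. u x = 0}"

definition critical_point :: "('a, 'n::finite) chart set \<Rightarrow> ('a \<Rightarrow> real) \<Rightarrow> 'a \<Rightarrow> bool"
  where "critical_point A u x \<longleftrightarrow> (\<forall>c\<in>A. x \<in> chart_dom c \<longrightarrow> differential u c x = 0)"

definition critical_value ::
    "'a topology \<Rightarrow> ('a, 'n::finite) chart set \<Rightarrow> ('a \<Rightarrow> real) \<Rightarrow> real \<Rightarrow> bool"
  where "critical_value M A u t \<longleftrightarrow> (\<exists>x\<in>topspace M. u x = t \<and> critical_point A u x)"

end

theory Submission
  imports Defs
begin

text \<open>For eigenfunctions \<open>u\<close> and \<open>v\<close> with the same eigenvalue, Green's identity says that the vector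
field \<open>u \<nabla>v - v \<nabla>u\<close> has divergence \<open>u \<Delta>v - v \<Delta>u = 0\<close>. On an oriented surface this means that
the 1-form \<open>\<eta> = *(u dv - v du)\<close> is closed. As the first cohomology vanishes, \<open>\<eta> = dF\<close> for some
function \<open>F\<close>. At a zero of \<open>u\<close> the form \<open>\<eta>\<close> is \<open>- v * du\<close>, and \<open>* du\<close> does not vanish on the
tangent line of the nodal curve as long as \<open>du \<noteq> 0\<close>. So along a component \<open>C\<close> of the nodal set
the derivative of \<open>F\<close> vanishes exactly at the zeros of \<open>v\<close>. Now \<open>C\<close> is compact, so \<open>F\<close> attains
a maximum and a minimum on \<open>C\<close>, and \<open>v\<close> vanishes at both. If the two points coincide, then \<open>F\<close>
is constant on \<open>C\<close>, every point of \<open>C\<close> is an extremum, and \<open>v\<close> vanishes on all of \<open>C\<close>, which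
has more than one point because it contains an arc of the nodal curve.

The cohomology hypothesis speaks of smooth forms, whereas \<open>u\<close> and \<open>v\<close> are only of class \<open>C\<^sup>2\<close>
and \<open>\<eta>\<close> only of class \<open>C\<^sup>1\<close>. Elliptic regularity is avoided by passing through local primitives: by
\<open>symmetric_derivative_imp_gradient\<close>, the Poincare lemma for \<open>C\<^sup>1\<close> fields, \<open>\<eta>\<close> is locally the
differential of functions \<open>\<phi>\<^sub>p\<close>. Two of them differ by a locally constant function. If \<open>\<rho>\<^sub>p\<close>
is a finite smooth partition of unity and \<open>\<Phi> = \<Sum> \<rho>\<^sub>p \<phi>\<^sub>p\<close>, then near every point \<open>\<eta> - d\<Phi>\<close>
is the differential of a linear combination of the \<open>\<rho>\<^sub>p\<close> with constant coefficients, hence a smooth closed form, and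
cohomology applies to it. This is \<open>locally_exact_imp_exact\<close>.

The star operator is written in coordinates: a function has the flux
\<open>sqrt |g| g\<^sup>-\<^sup>1 \<nabla>u\<close>, a vector density, and \<open>* du\<close> is its quarter turn up to the orientation sign
of the chart. Under a change of chart the quarter turn of the flux picks up the sign of the
Jacobian determinant (\<open>rot90_flux_change_of_chart\<close>), and the orientation signs compensate for it
(\<open>oriented_green_form_exact\<close>). The arc of the nodal curve through a point comes from the
inverse function theorem (\<open>level_curve\<close>, \<open>nodal_curve\<close>), and
\<open>extremum_on_nodal_component_imp_zero\<close> is the argument about extrema of \<open>F\<close>.\<close>


section \<open>Functions of class C^k\<close>

lemma Ck_on_subset: "Ck_on k f S \<Longrightarrow> T \<subseteq> S \<Longrightarrow> Ck_on k f T"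
  by (induction k arbitrary: f) (auto intro: continuous_on_subset)

lemma frechet_derivative_transform_on:
  assumes "open S" "x \<in> S" "\<And>y. y \<in> S \<Longrightarrow> f y = g y"
  shows "f differentiable (at x) \<longleftrightarrow> g differentiable (at x)"
    and "frechet_derivative f (at x) = frechet_derivative g (at x)"
proof -
  have *: "(f has_derivative D) (at x) \<longleftrightarrow> (g has_derivative D) (at x)" for D
    using assms has_derivative_transform_within_open[of f D x UNIV S g]
      has_derivative_transform_within_open[of g D x UNIV S f] by auto
  show "f differentiable (at x) \<longleftrightarrow> g differentiable (at x)"
    unfolding differentiable_def by (simp add: *)
  show "frechet_derivative f (at x) = frechet_derivative g (at x)"
    unfolding frechet_derivative_def by (simp add: *)
qed

lemma Ck_on_cong:
  assumes "open S" "Ck_on k f S" "\<And>x. x \<in> S \<Longrightarrow> f x = g x"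
  shows "Ck_on k g S"
  using assms(2,3)
proof (induction k arbitrary: f g)
  case 0
  then show ?case by (simp cong: continuous_on_cong)
next
  case (Suc k)
  note tr = frechet_derivative_transform_on[OF assms(1), of _ f g, OF _ Suc.prems(2)]
  show ?case
    unfolding Ck_on.simps
  proof (intro conjI ballI)
    show "g differentiable (at x)" if "x \<in> S" for x
      using Suc.prems(1) tr(1)[OF that] that by auto
    show "Ck_on k (\<lambda>x. frechet_derivative g (at x) b) S" if "b \<in> Basis" for b
      by (rule Suc.IH[of "\<lambda>x. frechet_derivative f (at x) b"]) (use Suc.prems(1) that tr(2) in auto)
  qed
qed

lemma Ck_on_local:
  assumes "\<And>x. x \<in> S \<Longrightarrow> \<exists>T. open T \<and> x \<in> T \<and> Ck_on k f T"
  shows "Ck_on k f S"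
  using assms
proof (induction k arbitrary: f)
  case 0
  have "isCont f x" if "x \<in> S" for x
    using 0[OF that] continuous_on_eq_continuous_at by (auto simp: continuous_on_eq_continuous_at)
  then show ?case by (simp add: continuous_at_imp_continuous_on)
next
  case (Suc k)
  have "Ck_on k (\<lambda>x. frechet_derivative f (at x) b) S" if "b \<in> Basis" for b
    by (rule Suc.IH) (use Suc.prems that in \<open>fastforce\<close>)
  with Suc.prems show ?case by fastforce
qed

text \<open>The recursive definition speaks of the chosen Frechet derivative. In practice a derivative \<open>D\<close>
is computed by the usual rules, and the inductions below apply the induction hypothesis
to the resulting formula for \<open>D\<close>.\<close>

lemma Ck_on_SucI:
  assumes "open S" "\<And>x. x \<in> S \<Longrightarrow> (f has_derivative D x) (at x)"
    and "\<And>b. b \<in> Basis \<Longrightarrow> Ck_on k (\<lambda>x. D x b) S"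
  shows "Ck_on (Suc k) f S"
  unfolding Ck_on.simps
proof (intro conjI ballI)
  show "f differentiable (at x)" if "x \<in> S" for x
    using assms(2)[OF that] by (auto simp: differentiable_def)
  show "Ck_on k (\<lambda>x. frechet_derivative f (at x) b) S" if "b \<in> Basis" for b
    by (rule Ck_on_cong[OF assms(1) assms(3)[OF that]])
      (use frechet_derivative_at[OF assms(2)] in metis)
qed

lemma Ck_on_SucD:
  assumes "Ck_on (Suc k) f S" "x \<in> S"
  shows "(f has_derivative frechet_derivative f (at x)) (at x)"
  using assms by (simp add: frechet_derivative_works)

lemma Ck_on_Suc_frechet_derivative:
  "Ck_on (Suc k) f S \<Longrightarrow> b \<in> Basis \<Longrightarrow> Ck_on k (\<lambda>x. frechet_derivative f (at x) b) S"
  by simp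

lemma Ck_on_Suc_imp: "Ck_on (Suc k) f S \<Longrightarrow> Ck_on k f S"
proof (induction k arbitrary: f)
  case 0
  then show ?case
    by (auto intro!: continuous_at_imp_continuous_on differentiable_imp_continuous_within)
next
  case (Suc k)
  show ?case
    unfolding Ck_on.simps(2)[of k]
    using Suc.IH Suc.prems[unfolded Ck_on.simps(2)[of "Suc k"]] by blast
qed

lemma Ck_on_const: "open S \<Longrightarrow> Ck_on k (\<lambda>x. a) S"
proof (induction k arbitrary: a)
  case (Suc k)
  show ?case by (rule Ck_on_SucI[where D="\<lambda>x h. 0"]) (use Suc in auto)
qed simp

lemma Ck_on_bounded_linear:
  assumes L: "bounded_linear L" and "open S" "Ck_on k f S"
  shows "Ck_on k (\<lambda>x. L (f x)) S"
  using assms(3)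
proof (induction k arbitrary: f)
  case 0
  then show ?case using linear_continuous_on_compose[OF _ ] L
    by (simp add: bounded_linear.continuous_on)
next
  case (Suc k)
  show ?case
    by (rule Ck_on_SucI[where D="\<lambda>x h. L (frechet_derivative f (at x) h)"])
      (use Suc assms bounded_linear.has_derivative[OF L Ck_on_SucD[OF Suc.prems]] in auto)
qed

lemma Ck_on_add:
  assumes "open S" "Ck_on k f S" "Ck_on k g S"
  shows "Ck_on k (\<lambda>x. f x + g x) S"
  using assms(2,3)
proof (induction k arbitrary: f g)
  case 0
  then show ?case by (simp add: continuous_on_add)
next
  case (Suc k)
  show ?case
    by (rule Ck_on_SucI[where D="\<lambda>x h. frechet_derivative f (at x) h + frechet_derivative g (at x) h"])
      (intro assms(1) has_derivative_add Ck_on_SucD[OF Suc.prems(1)] Ck_on_SucD[OF Suc.prems(2)]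
        Suc.IH Ck_on_Suc_frechet_derivative[OF Suc.prems(1)] Ck_on_Suc_frechet_derivative[OF Suc.prems(2)]; assumption)+
qed

text \<open>By the product rule the derivative of a bilinear expression is a sum of two bilinear
expressions of one order less, so a single induction covers products, scalings and inner
products.\<close>

lemma (in bounded_bilinear) Ck_on:
  assumes "open S" "Ck_on k f S" "Ck_on k g S"
  shows "Ck_on k (\<lambda>x. prod (f x) (g x)) S"
  using assms(2,3)
proof (induction k arbitrary: f g)
  case 0
  then show ?case by (simp add: continuous_on)
next
  case (Suc k)
  show ?case
  proof (rule Ck_on_SucI[OF assms(1)])
    show "((\<lambda>x. prod (f x) (g x)) has_derivative
        (\<lambda>h. prod (f x) (frechet_derivative g (at x) h) + prod (frechet_derivative f (at x) h) (g x))) (at x)"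
      if "x \<in> S" for x
      by (rule FDERIV[OF Ck_on_SucD[OF Suc.prems(1) that] Ck_on_SucD[OF Suc.prems(2) that]])
    show "Ck_on k (\<lambda>x. prod (f x) (frechet_derivative g (at x) b) + prod (frechet_derivative f (at x) b) (g x)) S"
      if "b \<in> Basis" for b
      using Suc.prems that
      by (intro Ck_on_add assms(1) Suc.IH Ck_on_Suc_imp[OF Suc.prems(1)] Ck_on_Suc_imp[OF Suc.prems(2)]) auto
  qed
qed

lemmas Ck_on_mult = bounded_bilinear.Ck_on[OF bounded_bilinear_mult]

lemmas Ck_on_scaleR = bounded_bilinear.Ck_on[OF bounded_bilinear_scaleR]

lemmas Ck_on_inner = bounded_bilinear.Ck_on[OF bounded_bilinear_inner]

lemma Ck_on_sum:
  assumes "open S" "\<And>i. i \<in> I \<Longrightarrow> Ck_on k (f i) S"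
  shows "Ck_on k (\<lambda>x. \<Sum>i\<in>I. f i x) S"
  using assms(2)
  by (induction I rule: infinite_finite_induct) (auto intro!: Ck_on_add Ck_on_const assms(1))

lemma Ck_on_diff:
  assumes "open S" "Ck_on k f S" "Ck_on k g S"
  shows "Ck_on k (\<lambda>x. f x - g x) S"
  using Ck_on_add[OF assms(1,2) Ck_on_bounded_linear[OF bounded_linear_minus[OF bounded_linear_ident] assms(1,3)]]
  by simp

lemma Ck_on_ident: "open S \<Longrightarrow> Ck_on k (\<lambda>x. x) S"
proof (cases k)
  case (Suc k)
  assume "open S"
  then show ?thesis unfolding Suc
    by (intro Ck_on_SucI[where D="\<lambda>x h. h"] Ck_on_const) auto
qed simp

text \<open>The derivative of \<open>1 / f\<close> is a polynomial in \<open>1 / f\<close> and the derivative of \<open>f\<close>, so the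
regularity of \<open>1 / f\<close> feeds its own induction step. The square root below behaves in the same way.\<close>

lemma Ck_on_inverse:
  fixes f :: "'a::euclidean_space \<Rightarrow> real"
  assumes "open S" "Ck_on k f S" "\<And>x. x \<in> S \<Longrightarrow> f x \<noteq> 0"
  shows "Ck_on k (\<lambda>x. inverse (f x)) S"
  using assms(2)
proof (induction k)
  case 0
  then show ?case using assms(3) by (auto intro: continuous_on_inverse)
next
  case (Suc k)
  note f = Suc.IH[OF Ck_on_Suc_imp[OF Suc.prems]]
  show ?case
  proof (rule Ck_on_SucI[OF assms(1)])
    show "((\<lambda>x. inverse (f x)) has_derivative
        (\<lambda>h. - (inverse (f x) * frechet_derivative f (at x) h * inverse (f x)))) (at x)" if "x \<in> S" for x
      by (rule Deriv.has_derivative_inverse[OF assms(3)[OF that] Ck_on_SucD[OF Suc.prems that]])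
    show "Ck_on k (\<lambda>x. - (inverse (f x) * frechet_derivative f (at x) b * inverse (f x))) S"
      if "b \<in> Basis" for b
      using Suc.prems that
      by (intro Ck_on_bounded_linear[OF bounded_linear_minus[OF bounded_linear_ident]] Ck_on_mult assms(1) f) auto
  qed
qed

lemma Ck_on_sqrt:
  fixes f :: "'a::euclidean_space \<Rightarrow> real"
  assumes "open S" "Ck_on k f S" "\<And>x. x \<in> S \<Longrightarrow> f x > 0"
  shows "Ck_on k (\<lambda>x. sqrt (f x)) S"
  using assms(2)
proof (induction k)
  case 0
  then show ?case by (auto intro!: continuous_intros)
next
  case (Suc k)
  note s = Suc.IH[OF Ck_on_Suc_imp[OF Suc.prems]]
  show ?case
  proof (rule Ck_on_SucI[OF assms(1)])
    fix x assume x: "x \<in> S"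
    have "(sqrt has_derivative (\<lambda>h. h * (inverse (sqrt (f x)) / 2))) (at (f x))"
      using DERIV_real_sqrt[OF assms(3)[OF x]]
      by (rule has_derivative_eq_rhs[OF has_field_derivative_imp_has_derivative]) (simp add: fun_eq_iff)
    from has_derivative_compose[OF Ck_on_SucD[OF Suc.prems x] this]
    show "((\<lambda>x. sqrt (f x)) has_derivative
        (\<lambda>h. frechet_derivative f (at x) h * (inverse (sqrt (f x)) / 2))) (at x)" .
  next
    fix b :: 'a assume b: "b \<in> Basis"
    have "Ck_on k (\<lambda>x. frechet_derivative f (at x) b * (inverse (sqrt (f x)) * inverse 2)) S"
      using assms(3)
      by (intro Ck_on_mult Ck_on_inverse Ck_on_const assms(1) s Ck_on_Suc_frechet_derivative[OF Suc.prems b])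
        (auto simp: less_imp_neq[symmetric])
    then show "Ck_on k (\<lambda>x. frechet_derivative f (at x) b * (inverse (sqrt (f x)) / 2)) S"
      by (simp only: divide_inverse)
  qed
qed

text \<open>The chain rule in a form suited to induction: with the derivative of \<open>f\<close> expanded over the basis,
only basis directions occur in it, as in the definition of the class.\<close>

lemma Ck_on_compose:
  assumes "open U" "open V" "Ck_on k f V" "Ck_on k T U" "T ` U \<subseteq> V"
  shows "Ck_on k (\<lambda>x. f (T x)) U"
  using assms(3,4)
proof (induction k arbitrary: f)
  case 0
  then show ?case using continuous_on_compose2[OF _ _ assms(5), of f] by auto
next
  case (Suc k)
  note T = Ck_on_SucD[OF Suc.prems(2)]
  show ?case
  proof (rule Ck_on_SucI[OF assms(1)])
    fix x assume x: "x \<in> U"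
    then have Tx: "T x \<in> V" using assms(5) by auto
    let ?D = "frechet_derivative f (at (T x))"
    have "((\<lambda>x. f (T x)) has_derivative (\<lambda>h. ?D (frechet_derivative T (at x) h))) (at x)"
      by (rule has_derivative_compose[OF T[OF x] Ck_on_SucD[OF Suc.prems(1) Tx]])
    also have "(\<lambda>h. ?D (frechet_derivative T (at x) h)) =
        (\<lambda>h. \<Sum>j\<in>Basis. (frechet_derivative T (at x) h \<bullet> j) *\<^sub>R ?D j)"
    proof
      fix h
      have lin: "linear ?D" by (rule has_derivative_linear[OF Ck_on_SucD[OF Suc.prems(1) Tx]])
      have "?D (frechet_derivative T (at x) h) =
          ?D (\<Sum>j\<in>Basis. (frechet_derivative T (at x) h \<bullet> j) *\<^sub>R j)"
        by (simp only: euclidean_representation)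
      then show "?D (frechet_derivative T (at x) h) =
          (\<Sum>j\<in>Basis. (frechet_derivative T (at x) h \<bullet> j) *\<^sub>R ?D j)"
        by (simp only: linear_sum[OF lin] linear_cmul[OF lin])
    qed
    finally show "((\<lambda>x. f (T x)) has_derivative
        (\<lambda>h. \<Sum>j\<in>Basis. (frechet_derivative T (at x) h \<bullet> j) *\<^sub>R ?D j)) (at x)" .
  next
    fix b :: 'a assume b: "b \<in> Basis"
    show "Ck_on k (\<lambda>x. \<Sum>j\<in>Basis. (frechet_derivative T (at x) b \<bullet> j) *\<^sub>R
        frechet_derivative f (at (T x)) j) U"
      using Suc.prems b
      by (intro Ck_on_sum Ck_on_scaleR assms(1) Ck_on_inner Ck_on_const Suc.IH Ck_on_Suc_imp[OF Suc.prems(2)]) auto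
  qed
qed

lemma smooth_on_imp_Ck_on: "smooth_on f S \<Longrightarrow> Ck_on k f S"
  by (simp add: smooth_on_def)

lemma Ck_on_vec:
  fixes f :: "'a::euclidean_space \<Rightarrow> real^'n"
  assumes "open S" "\<And>i. Ck_on k (\<lambda>x. f x $ i) S"
  shows "Ck_on k f S"
proof -
  have "Ck_on k (\<lambda>x. \<Sum>i\<in>UNIV. f x $ i *\<^sub>R (axis i 1 :: real^'n)) S"
    by (intro Ck_on_sum Ck_on_scaleR Ck_on_const assms)
  moreover have "(\<Sum>i\<in>UNIV. f x $ i *\<^sub>R (axis i 1 :: real^'n)) = f x" for x
    using basis_expansion[of "f x"] by (simp only: scalar_mult_eq_scaleR)
  ultimately show ?thesis by (simp only:)
qed

lemma Ck_on_nth: "open S \<Longrightarrow> Ck_on k f S \<Longrightarrow> Ck_on k (\<lambda>x. f x $ i) S"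
  by (rule Ck_on_bounded_linear[OF bounded_linear_vec_nth])

lemma continuous_on_frechet_derivative:
  assumes "Ck_on (Suc 0) f S"
  shows "continuous_on S (\<lambda>x. frechet_derivative f (at x) h)"
proof -
  have "continuous_on S (\<lambda>x. \<Sum>b\<in>Basis. (h \<bullet> b) *\<^sub>R frechet_derivative f (at x) b)"
    using assms by (intro continuous_intros) simp
  then show ?thesis
  proof (rule continuous_on_eq)
    fix x assume "x \<in> S"
    then have lin: "linear (frechet_derivative f (at x))"
      by (rule has_derivative_linear[OF Ck_on_SucD[OF assms]])
    have "frechet_derivative f (at x) h = frechet_derivative f (at x) (\<Sum>b\<in>Basis. (h \<bullet> b) *\<^sub>R b)"
      by (simp only: euclidean_representation)
    then show "(\<Sum>b\<in>Basis. (h \<bullet> b) *\<^sub>R frechet_derivative f (at x) b) = frechet_derivative f (at x) h"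
      by (simp only: linear_sum[OF lin] linear_cmul[OF lin])
  qed
qed

lemma Ck_on_imp_partial_deriv:
  assumes "Ck_on (Suc k) f S"
  shows "Ck_on k (partial_deriv i f) S"
  using assms by (auto simp: partial_deriv_def[abs_def] axis_in_Basis_iff)

lemma Ck_on_imp_GDERIV:
  fixes f :: "real^'n \<Rightarrow> real"
  assumes "Ck_on (Suc k) f S" "x \<in> S"
  shows "GDERIV f x :> (\<chi> i. partial_deriv i f x)"
proof -
  let ?D = "frechet_derivative f (at x)"
  have "linear ?D"
    by (rule has_derivative_linear[OF Ck_on_SucD[OF assms]])
  have "?D = (\<lambda>h. h \<bullet> (\<chi> i. ?D (axis i 1)))"
  proof
    fix h
    have "?D h = ?D (\<Sum>i\<in>UNIV. h $ i *\<^sub>R axis i 1)"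
      using basis_expansion[of h] by (simp only: scalar_mult_eq_scaleR)
    also have "\<dots> = (\<Sum>i\<in>UNIV. h $ i * ?D (axis i 1))"
      by (simp only: linear_sum[OF \<open>linear ?D\<close>] linear_cmul[OF \<open>linear ?D\<close>] real_scaleR_def)
    finally show "?D h = h \<bullet> (\<chi> i. ?D (axis i 1))" by (simp add: inner_vec_def)
  qed
  then show ?thesis
    unfolding gderiv_def partial_deriv_def by (rule has_derivative_eq_rhs[OF Ck_on_SucD[OF assms]])
qed

lemma GDERIV_imp_partial_deriv:
  assumes "GDERIV f x :> D"
  shows "partial_deriv i f x = D $ i"
proof -
  have "(\<lambda>h. h \<bullet> D) = frechet_derivative f (at x)"
    using assms unfolding gderiv_def by (rule frechet_derivative_at)
  then have "frechet_derivative f (at x) (axis i 1) = axis i 1 \<bullet> D"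
    by (rule fun_cong[symmetric])
  then show ?thesis by (simp add: partial_deriv_def inner_axis')
qed

lemma GDERIV_transform_open:
  assumes "GDERIV f x :> D" "open S" "x \<in> S" "\<And>y. y \<in> S \<Longrightarrow> f y = g y"
  shows "GDERIV g x :> D"
  using assms unfolding gderiv_def by (rule has_derivative_transform_within_open)

lemma partial_deriv_nth:
  assumes "(F has_derivative D) (at x)"
  shows "partial_deriv i (\<lambda>x. F x $ j) x = D (axis i 1) $ j"
proof -
  have "((\<lambda>x. F x $ j) has_derivative (\<lambda>h. D h $ j)) (at x)"
    by (rule bounded_linear.has_derivative[OF bounded_linear_vec_nth assms])
  from frechet_derivative_at[OF this] show ?thesis
    unfolding partial_deriv_def by (rule fun_cong[symmetric])
qed

section \<open>Symmetry of second derivatives and local potentials\<close>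

text \<open>Two applications of the mean value theorem, first in the direction \<open>a\<close> and then in the direction \<open>b\<close>.\<close>

lemma second_difference_mean_value:
  fixes f :: "'a::euclidean_space \<Rightarrow> real"
  assumes f: "Ck_on 2 f S" and ab: "a \<in> Basis" "b \<in> Basis" and "s > 0"
    and S: "\<And>\<sigma> \<tau>. \<sigma> \<in> {0..s} \<Longrightarrow> \<tau> \<in> {0..s} \<Longrightarrow> x + \<sigma> *\<^sub>R a + \<tau> *\<^sub>R b \<in> S"
  shows "\<exists>\<sigma>\<in>{0..s}. \<exists>\<tau>\<in>{0..s}.
    f (x + s *\<^sub>R a + s *\<^sub>R b) - f (x + s *\<^sub>R a) - f (x + s *\<^sub>R b) + f x =
    s * s * frechet_derivative (\<lambda>y. frechet_derivative f (at y) a) (at (x + \<sigma> *\<^sub>R a + \<tau> *\<^sub>R b)) b"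
proof -
  let ?D = "\<lambda>y. frechet_derivative f (at y)"
  let ?g = "\<lambda>\<sigma>. f (x + \<sigma> *\<^sub>R a + s *\<^sub>R b) - f (x + \<sigma> *\<^sub>R a + 0 *\<^sub>R b)"
  have f1: "Ck_on (Suc (Suc 0)) f S" using f unfolding numeral_2_eq_2 .
  have f2: "Ck_on (Suc 0) (\<lambda>y. ?D y a) S" using f1 ab by simp
  have d: "((\<lambda>\<sigma>. f (x + \<sigma> *\<^sub>R a + t *\<^sub>R b)) has_derivative (\<lambda>h. h * ?D (x + \<sigma> *\<^sub>R a + t *\<^sub>R b) a)) (at \<sigma>)"
    if "\<sigma> \<in> {0..s}" "t \<in> {0..s}" for \<sigma> t
  proof -
    note D = Ck_on_SucD[OF f1 S[OF that]]
    have "((\<lambda>\<sigma>. f (x + \<sigma> *\<^sub>R a + t *\<^sub>R b)) has_derivative (\<lambda>h. ?D (x + \<sigma> *\<^sub>R a + t *\<^sub>R b) (h *\<^sub>R a))) (at \<sigma>)"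
      by (rule has_derivative_compose[where g=f and f="\<lambda>\<sigma>. x + \<sigma> *\<^sub>R a + t *\<^sub>R b", OF _ D]) (auto intro!: derivative_eq_intros)
    then show ?thesis by (simp only: linear_cmul[OF has_derivative_linear[OF D]] real_scaleR_def)
  qed
  have d2: "((\<lambda>\<tau>. ?D (x + \<sigma> *\<^sub>R a + \<tau> *\<^sub>R b) a) has_derivative
       (\<lambda>h. h * frechet_derivative (\<lambda>y. ?D y a) (at (x + \<sigma> *\<^sub>R a + \<tau> *\<^sub>R b)) b)) (at \<tau>)"
    if "\<sigma> \<in> {0..s}" "\<tau> \<in> {0..s}" for \<sigma> \<tau>
  proof -
    note D = Ck_on_SucD[OF f2 S[OF that]]
    have "((\<lambda>\<tau>. ?D (x + \<sigma> *\<^sub>R a + \<tau> *\<^sub>R b) a) has_derivative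
       (\<lambda>h. frechet_derivative (\<lambda>y. ?D y a) (at (x + \<sigma> *\<^sub>R a + \<tau> *\<^sub>R b)) (h *\<^sub>R b))) (at \<tau>)"
      by (rule has_derivative_compose[where g="\<lambda>y. ?D y a" and f="\<lambda>\<tau>. x + \<sigma> *\<^sub>R a + \<tau> *\<^sub>R b", OF _ D]) (auto intro!: derivative_eq_intros)
    then show ?thesis by (simp only: linear_cmul[OF has_derivative_linear[OF D]] real_scaleR_def)
  qed
  have "\<exists>\<sigma>\<in>{0<..<s}. ?g s - ?g 0 = (s - 0) * ?D (x + \<sigma> *\<^sub>R a + s *\<^sub>R b) a - (s - 0) * ?D (x + \<sigma> *\<^sub>R a + 0 *\<^sub>R b) a"
    by (rule mvt_simple[OF \<open>s > 0\<close>, where f = ?g and f' = "\<lambda>\<sigma> h. h * ?D (x + \<sigma> *\<^sub>R a + s *\<^sub>R b) a - h * ?D (x + \<sigma> *\<^sub>R a + 0 *\<^sub>R b) a"])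
      (rule has_derivative_at_withinI, rule has_derivative_diff; rule d; use \<open>s > 0\<close> in auto)
  then obtain \<sigma> where \<sigma>: "\<sigma> \<in> {0<..<s}" "?g s - ?g 0 = s * (?D (x + \<sigma> *\<^sub>R a + s *\<^sub>R b) a - ?D (x + \<sigma> *\<^sub>R a + 0 *\<^sub>R b) a)"
    by (auto simp: algebra_simps)
  have "\<exists>\<tau>\<in>{0<..<s}. ?D (x + \<sigma> *\<^sub>R a + s *\<^sub>R b) a - ?D (x + \<sigma> *\<^sub>R a + 0 *\<^sub>R b) a =
      (s - 0) * frechet_derivative (\<lambda>y. ?D y a) (at (x + \<sigma> *\<^sub>R a + \<tau> *\<^sub>R b)) b"
    by (rule mvt_simple[OF \<open>s > 0\<close>, where f = "\<lambda>\<tau>. ?D (x + \<sigma> *\<^sub>R a + \<tau> *\<^sub>R b) a" and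
        f' = "\<lambda>\<tau> h. h * frechet_derivative (\<lambda>y. ?D y a) (at (x + \<sigma> *\<^sub>R a + \<tau> *\<^sub>R b)) b"])
      (rule has_derivative_at_withinI, rule d2; use \<sigma> in auto)
  then obtain \<tau> where \<tau>: "\<tau> \<in> {0<..<s}" "?D (x + \<sigma> *\<^sub>R a + s *\<^sub>R b) a - ?D (x + \<sigma> *\<^sub>R a + 0 *\<^sub>R b) a =
      s * frechet_derivative (\<lambda>y. ?D y a) (at (x + \<sigma> *\<^sub>R a + \<tau> *\<^sub>R b)) b" by auto
  show ?thesis
    by (rule bexI[of _ \<sigma>], rule bexI[of _ \<tau>]) (use \<sigma> \<tau> in auto)
qed

text \<open>The second difference is symmetric in \<open>a\<close> and \<open>b\<close>. So arbitrarily close to \<open>x\<close> there are points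
at which the two mixed derivatives agree, and by continuity they agree at \<open>x\<close>.\<close>

lemma second_derivative_symmetric:
  fixes f :: "'a::euclidean_space \<Rightarrow> real"
  assumes "open S" "x \<in> S" and f: "Ck_on 2 f S" and ab: "a \<in> Basis" "b \<in> Basis"
  shows "frechet_derivative (\<lambda>y. frechet_derivative f (at y) a) (at x) b =
    frechet_derivative (\<lambda>y. frechet_derivative f (at y) b) (at x) a"
proof (rule ccontr)
  define P where "P a b = (\<lambda>x. frechet_derivative (\<lambda>y. frechet_derivative f (at y) a) (at x) b)" for a b
  assume "\<not> ?thesis"
  then have ne: "P a b x \<noteq> P b a x" by (simp add: P_def)
  \<comment> \<open>Near \<open>x\<close> both mixed derivatives stay within half of their distance, so they cannot be equal there.\<close>
  define e where "e = \<bar>P a b x - P b a x\<bar> / 2"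
  have e: "e > 0" using ne by (simp add: e_def)
  have "isCont (P a' b') x" if "a' \<in> Basis" "b' \<in> Basis" for a' b'
    using f that assms(1,2) by (auto simp: P_def numeral_2_eq_2 continuous_on_eq_continuous_at)
  then have "\<forall>\<^sub>F y in nhds x. y \<in> S \<and> dist (P a b y) (P a b x) < e \<and> dist (P b a y) (P b a x) < e"
    using ab assms(1,2) e
    by (intro eventually_conj eventually_nhds_in_open tendstoD tendsto_at_iff_tendsto_nhds[THEN iffD1])
      (auto simp: isCont_def)
  then obtain d where d: "d > 0"
    "\<And>y. dist y x < d \<Longrightarrow> y \<in> S \<and> dist (P a b y) (P a b x) < e \<and> dist (P b a y) (P b a x) < e"
    by (auto simp: eventually_nhds_metric)
  define s where "s = d / 3"
  have s: "s > 0" using d by (simp add: s_def)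
  have close: "dist (x + \<sigma> *\<^sub>R a' + \<tau> *\<^sub>R b') x < d"
    if "\<sigma> \<in> {0..s}" "\<tau> \<in> {0..s}" "a' \<in> Basis" "b' \<in> Basis" for \<sigma> \<tau> and a' b' :: 'a
  proof -
    have "dist (x + \<sigma> *\<^sub>R a' + \<tau> *\<^sub>R b') x = norm (\<sigma> *\<^sub>R a' + \<tau> *\<^sub>R b')"
      by (simp add: dist_norm)
    also have "\<dots> \<le> norm (\<sigma> *\<^sub>R a') + norm (\<tau> *\<^sub>R b')" by (rule norm_triangle_ineq)
    also have "\<dots> \<le> s + s" using that by auto
    also have "\<dots> < d" using d(1) by (simp add: s_def)
    finally show ?thesis .
  qed
  let ?\<Delta> = "f (x + s *\<^sub>R a + s *\<^sub>R b) - f (x + s *\<^sub>R a) - f (x + s *\<^sub>R b) + f x"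
  obtain y where y: "dist y x < d" "?\<Delta> = s * s * P a b y"
    using second_difference_mean_value[OF f ab s, of x] close d(2) ab unfolding P_def by meson
  obtain z where z: "dist z x < d" "?\<Delta> = s * s * P b a z"
  proof -
    have "\<exists>\<sigma>\<in>{0..s}. \<exists>\<tau>\<in>{0..s}.
      f (x + s *\<^sub>R b + s *\<^sub>R a) - f (x + s *\<^sub>R b) - f (x + s *\<^sub>R a) + f x = s * s * P b a (x + \<sigma> *\<^sub>R b + \<tau> *\<^sub>R a)"
      unfolding P_def by (rule second_difference_mean_value[OF f ab(2,1) s]) (use close d(2) ab in blast)
    then obtain \<sigma> \<tau> where st: "\<sigma>\<in>{0..s}" "\<tau>\<in>{0..s}"
      "f (x + s *\<^sub>R b + s *\<^sub>R a) - f (x + s *\<^sub>R b) - f (x + s *\<^sub>R a) + f x = s * s * P b a (x + \<sigma> *\<^sub>R b + \<tau> *\<^sub>R a)"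
      by blast
    show ?thesis
      by (rule that[of "x + \<sigma> *\<^sub>R b + \<tau> *\<^sub>R a"]) (use st close ab in \<open>auto simp: algebra_simps\<close>)
  qed
  have "P a b y = P b a z" using y(2) z(2) s by simp
  then show False
    using d(2)[OF y(1)] d(2)[OF z(1)] unfolding e_def dist_real_def by (auto simp: abs_if split: if_splits)
qed

lemma partial_deriv_commute:
  assumes "open S" "x \<in> S" "Ck_on 2 f S"
  shows "partial_deriv i (partial_deriv j f) x = partial_deriv j (partial_deriv i f) x"
  unfolding partial_deriv_def[abs_def]
  by (rule second_derivative_symmetric[OF assms]) (auto simp: axis_in_Basis_iff)

text \<open>The Poincare lemma for 1-forms of class \<open>C\<^sup>1\<close> on a convex open set. The potential is the integral of
\<open>W\<close> along the segments from a base point \<open>p\<close>. Differentiating under the integral sign gives an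
integrand that, thanks to the symmetry of \<open>DW\<close>, is the derivative of
\<open>t * (W (p + t (x - p)) \<bullet> h)\<close> with respect to \<open>t\<close>.\<close>

lemma symmetric_derivative_imp_gradient:
  fixes W :: "'a::euclidean_space \<Rightarrow> 'a"
  assumes "convex S" "open S"
    and der: "\<And>x. x \<in> S \<Longrightarrow> (W has_derivative DW x) (at x)"
    and cont: "\<And>h. continuous_on S (\<lambda>x. DW x h)"
    and sym: "\<And>x h k. x \<in> S \<Longrightarrow> DW x h \<bullet> k = DW x k \<bullet> h"
  shows "\<exists>\<phi>. \<forall>x\<in>S. GDERIV \<phi> x :> W x"
proof (cases "S = {}")
  case False
  then obtain p where p: "p \<in> S" by blast
  define l where "l x t = p + t *\<^sub>R (x - p)" for x and t :: real
  have l: "l x t \<in> S" if "x \<in> S" "t \<in> cbox 0 1" for x t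
  proof -
    have "l x t = (1 - t) *\<^sub>R p + t *\<^sub>R x" by (simp add: l_def algebra_simps)
    then show ?thesis using convexD_alt[OF assms(1) p that(1), of t] that(2) by simp
  qed
  have lin: "bounded_linear (DW x)" if "x \<in> S" for x
    using der[OF that] by (rule has_derivative_bounded_linear)
  have contW: "continuous_on S W"
    using der has_derivative_continuous by (blast intro: continuous_at_imp_continuous_on)
  define f where "f x t = W (l x t) \<bullet> (x - p)" for x t
  \<comment> \<open>The derivative of the integrand \<open>f x t\<close> with respect to \<open>x\<close>.\<close>
  define D where "D x t h = t * (DW (l x t) h \<bullet> (x - p)) + W (l x t) \<bullet> h" for x t h
  have D_lin: "bounded_linear (D x t)" if "x \<in> S" "t \<in> cbox 0 1" for x t
    unfolding D_def
    by (intro bounded_linear_add bounded_linear_const_mult bounded_linear_inner_right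
        bounded_linear_compose[OF bounded_linear_inner_left lin[OF l[OF that]]])
  define fx where "fx x t = Blinfun (D x t)" for x t
  have fx: "blinfun_apply (fx x t) = D x t" if "x \<in> S" "t \<in> cbox 0 1" for x t
    unfolding fx_def by (rule bounded_linear_Blinfun_apply[OF D_lin[OF that]])
  have contl: "continuous_on T (\<lambda>z. l (fst z) (snd z))" for T
    unfolding l_def by (intro continuous_intros)
  have lT: "(\<lambda>z. l (fst z) (snd z)) ` (S \<times> cbox 0 1) \<subseteq> S" using l by auto
  have cont_fx: "continuous_on (S \<times> cbox 0 1) (\<lambda>(x, t). fx x t)"
  proof (rule continuous_on_blinfun_componentwise)
    fix h :: 'a assume "h \<in> Basis"
    have "continuous_on (S \<times> cbox 0 1) (\<lambda>z. D (fst z) (snd z) h)"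
      unfolding D_def
      by (intro continuous_intros continuous_on_compose2[OF cont contl lT] continuous_on_compose2[OF contW contl lT])
    then show "continuous_on (S \<times> cbox 0 1) (\<lambda>z. blinfun_apply (case z of (x, t) \<Rightarrow> fx x t) h)"
      by (rule continuous_on_eq) (auto simp: fx)
  qed
  define \<phi> where "\<phi> x = integral (cbox 0 1) (f x)" for x
  have "GDERIV \<phi> x :> W x" if x: "x \<in> S" for x
  proof -
    have contlx: "continuous_on (cbox 0 1) (l y)" for y
      unfolding l_def by (intro continuous_intros)
    have der_l: "((\<lambda>x. l x t) has_derivative (\<lambda>h. t *\<^sub>R h)) (at y)" for t y
      unfolding l_def by (auto intro!: derivative_eq_intros)
    have "(\<phi> has_derivative blinfun_apply (integral (cbox 0 1) (fx x))) (at x within S)"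
      unfolding \<phi>_def
    proof (rule leibniz_rule[OF _ _ cont_fx x assms(1)])
      fix y assume y: "y \<in> S"
      have "continuous_on (cbox 0 1) (f y)"
        unfolding f_def using l[OF y]
        by (intro continuous_intros continuous_on_compose2[OF contW contlx]) auto
      then show "f y integrable_on cbox 0 1" by (rule integrable_continuous)
      fix t :: real assume t: "t \<in> cbox 0 1"
      have "((\<lambda>x. W (l x t)) has_derivative (\<lambda>h. DW (l y t) (t *\<^sub>R h))) (at y)"
        by (rule has_derivative_compose[OF der_l der[OF l[OF y t]]])
      from has_derivative_inner[OF this has_derivative_diff[OF has_derivative_ident has_derivative_const[of p]]]
      have "((\<lambda>x. f x t) has_derivative (\<lambda>h. W (l y t) \<bullet> (h - 0) + DW (l y t) (t *\<^sub>R h) \<bullet> (y - p))) (at y)"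
        unfolding f_def .
      also have "(\<lambda>h. W (l y t) \<bullet> (h - 0) + DW (l y t) (t *\<^sub>R h) \<bullet> (y - p)) = D y t"
        using linear_cmul[OF bounded_linear.linear[OF lin[OF l[OF y t]]]] by (simp add: D_def fun_eq_iff)
      finally show "((\<lambda>x. f x t) has_derivative blinfun_apply (fx y t)) (at y within S)"
        unfolding fx[OF y t] by (rule has_derivative_at_withinI)
    qed
    moreover have "blinfun_apply (integral (cbox 0 1) (fx x)) = (\<lambda>h. h \<bullet> W x)"
    proof
      fix h
      have "continuous_on (cbox 0 1) (\<lambda>t. (\<lambda>(x, t). fx x t) (x, t))"
        by (rule continuous_on_compose2[OF cont_fx]) (auto intro!: continuous_intros x)
      then have "fx x integrable_on cbox 0 1" by (intro integrable_continuous) simp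
      then have "blinfun_apply (integral (cbox 0 1) (fx x)) h = integral (cbox 0 1) (\<lambda>t. fx x t h)"
        by (rule blinfun_apply_integral)
      also have "\<dots> = integral {0..1} (\<lambda>t. D x t h)"
        unfolding cbox_interval[symmetric] by (rule integral_cong) (simp add: fx[OF x])
      also have "((\<lambda>t. D x t h) has_integral (1 * (W (l x 1) \<bullet> h) - 0 * (W (l x 0) \<bullet> h))) {0..1}"
      proof (rule fundamental_theorem_of_calculus)
        fix t :: real assume t: "t \<in> {0..1}"
        then have lt: "l x t \<in> S" using l[OF x] by simp
        have "(l x has_derivative (\<lambda>s. s *\<^sub>R (x - p))) (at t)"
          unfolding l_def by (auto intro!: derivative_eq_intros)
        from has_derivative_compose[OF this der[OF lt]]
        have "((\<lambda>t. W (l x t)) has_derivative (\<lambda>s. DW (l x t) (s *\<^sub>R (x - p)))) (at t)" .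
        from has_derivative_mult[OF has_derivative_ident has_derivative_inner_left[OF this, of h]]
        have "((\<lambda>t. t * (W (l x t) \<bullet> h)) has_derivative
            (\<lambda>s. t * (DW (l x t) (s *\<^sub>R (x - p)) \<bullet> h) + s * (W (l x t) \<bullet> h))) (at t)" .
        moreover have "t * (DW (l x t) (s *\<^sub>R (x - p)) \<bullet> h) + s * (W (l x t) \<bullet> h) = s *\<^sub>R D x t h" for s
          unfolding D_def linear_cmul[OF bounded_linear.linear[OF lin[OF lt]]] inner_scaleR_left
            sym[OF lt, of "x - p" h]
          by (simp add: distrib_left mult.left_commute)
        ultimately have "((\<lambda>t. t * (W (l x t) \<bullet> h)) has_vector_derivative D x t h) (at t)"
          by (simp add: has_vector_derivative_def)
        then show "((\<lambda>t. t * (W (l x t) \<bullet> h)) has_vector_derivative D x t h) (at t within {0..1})"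
          by (rule has_vector_derivative_at_within)
      qed simp
      then have "integral {0..1} (\<lambda>t. D x t h) = W x \<bullet> h"
        by (simp add: integral_unique l_def)
      finally show "blinfun_apply (integral (cbox 0 1) (fx x)) h = h \<bullet> W x"
        by (simp add: inner_commute)
    qed
    ultimately show ?thesis
      by (simp add: gderiv_def at_within_open[OF x assms(2)])
  qed
  then show ?thesis by blast
qed simp

section \<open>Charts and transition maps\<close>

lemma is_chart_inj_on: "is_chart M c \<Longrightarrow> inj_on (chart_map c) (chart_dom c)"
  using openin_subset[of M "chart_dom c"]
  by (auto simp: is_chart_def homeomorphic_eq_everything_map inf_absorb2)

lemma chart_inv_chart_map: "is_chart M c \<Longrightarrow> p \<in> chart_dom c \<Longrightarrow> chart_inv c (chart_map c p) = p"
  by (simp add: chart_inv_def inv_into_f_f is_chart_inj_on)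

lemma chart_map_chart_inv: "x \<in> chart_img c \<Longrightarrow> chart_map c (chart_inv c x) = x"
  by (simp add: chart_inv_def chart_img_def f_inv_into_f)

lemma chart_inv_in_dom: "x \<in> chart_img c \<Longrightarrow> chart_inv c x \<in> chart_dom c"
  by (simp add: chart_inv_def chart_img_def inv_into_into)

lemma chart_map_in_img: "p \<in> chart_dom c \<Longrightarrow> chart_map c p \<in> chart_img c"
  by (simp add: chart_img_def)

lemma open_chart_img: "is_chart M c \<Longrightarrow> open (chart_img c)"
  by (simp add: is_chart_def)

lemma openin_chart_dom: "is_chart M c \<Longrightarrow> openin M (chart_dom c)"
  by (simp add: is_chart_def)

lemma in_coords_chart_map [simp]: "is_chart M c \<Longrightarrow> p \<in> chart_dom c \<Longrightarrow> in_coords c f (chart_map c p) = f p"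
  by (simp add: in_coords_def chart_inv_chart_map)

lemma open_chart_image:
  assumes "is_chart M c" "openin M W"
  shows "open (chart_map c ` (chart_dom c \<inter> W))"
proof -
  have "open_map (subtopology M (chart_dom c)) (top_of_set (chart_img c)) (chart_map c)"
    using assms(1) by (auto simp: is_chart_def homeomorphic_eq_everything_map)
  moreover have "openin (subtopology M (chart_dom c)) (chart_dom c \<inter> W)"
    using assms(2) openin_subtopology_Int2 by blast
  ultimately have "openin (top_of_set (chart_img c)) (chart_map c ` (chart_dom c \<inter> W))"
    by (simp add: open_map_def)
  then show ?thesis using open_chart_img[OF assms(1)] openin_open_eq by blast
qed

lemma openin_chart_vimage:
  assumes "is_chart M c" "open V"
  shows "openin M {p \<in> chart_dom c. chart_map c p \<in> V}"
proof -
  note dom = openin_chart_dom[OF assms(1)]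
  have "continuous_map (subtopology M (chart_dom c)) (top_of_set (chart_img c)) (chart_map c)"
    using assms(1) by (auto simp: is_chart_def homeomorphic_eq_everything_map)
  then have "continuous_map (subtopology M (chart_dom c)) euclidean (chart_map c)"
    using continuous_map_in_subtopology by blast
  then have "openin (subtopology M (chart_dom c)) {p \<in> topspace (subtopology M (chart_dom c)). chart_map c p \<in> V}"
    using assms(2) by (simp add: continuous_map_def)
  then show ?thesis
    using openin_trans_full[OF _ dom] topspace_subtopology_subset[OF openin_subset[OF dom]]
    by (simp del: topspace_subtopology)
qed

lemma continuous_map_chart_inv:
  assumes "is_chart M c"
  shows "continuous_map (top_of_set (chart_img c)) M (chart_inv c)"
  unfolding continuous_map_def
proof (intro conjI allI impI)
  show "chart_inv c \<in> topspace (top_of_set (chart_img c)) \<rightarrow> topspace M"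
    using chart_inv_in_dom openin_subset[OF openin_chart_dom[OF assms]] by fastforce
  fix W assume "openin M W"
  have "{x \<in> chart_img c. chart_inv c x \<in> W} = chart_map c ` (chart_dom c \<inter> W)"
    using chart_inv_chart_map[OF assms]
    by (force simp: chart_map_in_img image_iff chart_map_chart_inv chart_inv_in_dom
        intro: chart_map_chart_inv[symmetric])
  then show "openin (top_of_set (chart_img c)) {x \<in> topspace (top_of_set (chart_img c)). chart_inv c x \<in> W}"
    using open_chart_image[OF assms \<open>openin M W\<close>]
    by (simp add: openin_open_eq[OF open_chart_img[OF assms]]) (auto simp: chart_img_def)
qed

lemma compactin_chart_inv_image:
  assumes "is_chart M c" "compact K" "K \<subseteq> chart_img c"
  shows "compactin M (chart_inv c ` K)"
  using assms by (intro image_compactin[OF _ continuous_map_chart_inv]) (auto simp: compactin_subtopology)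

lemma smooth_atlas_is_chart: "smooth_atlas M A \<Longrightarrow> c \<in> A \<Longrightarrow> is_chart M c"
  by (simp add: smooth_atlas_def)

lemma smooth_atlas_topspace: "smooth_atlas M A \<Longrightarrow> topspace M = (\<Union>c\<in>A. chart_dom c)"
  by (simp add: smooth_atlas_def)

lemma open_overlap:
  assumes "is_chart M c" "is_chart M c'"
  shows "open (chart_map c ` (chart_dom c \<inter> chart_dom c'))"
  by (rule open_chart_image[OF assms(1) openin_chart_dom[OF assms(2)]])

lemma smooth_on_transition:
  "smooth_atlas M A \<Longrightarrow> c \<in> A \<Longrightarrow> c' \<in> A \<Longrightarrow>
    smooth_on (transition c c') (chart_map c ` (chart_dom c \<inter> chart_dom c'))"
  by (simp add: smooth_atlas_def)

lemma transition_chart_map: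
  "is_chart M c \<Longrightarrow> p \<in> chart_dom c \<Longrightarrow> transition c c' (chart_map c p) = chart_map c' p"
  by (simp add: transition_def chart_inv_chart_map)

lemma in_coords_transition:
  assumes "is_chart M c" "is_chart M c'" "x \<in> chart_map c ` (chart_dom c \<inter> chart_dom c')"
  shows "in_coords c' f (transition c c' x) = in_coords c f x"
  using assms by (auto simp: in_coords_def transition_def chart_inv_chart_map)

lemma transition_has_derivative:
  assumes "smooth_atlas M A" "c \<in> A" "c' \<in> A" "p \<in> chart_dom c" "p \<in> chart_dom c'"
  shows "(transition c c' has_derivative (\<lambda>h. transition_jacobian c c' p *v h)) (at (chart_map c p))"
proof -
  have "Ck_on (Suc 0) (transition c c') (chart_map c ` (chart_dom c \<inter> chart_dom c'))"
    using smooth_on_transition[OF assms(1-3)] by (rule smooth_on_imp_Ck_on)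
  then have "transition c c' differentiable (at (chart_map c p))"
    using assms(4,5) by simp
  then show ?thesis unfolding transition_jacobian_def by (simp add: jacobian_works)
qed

lemma transition_jacobian_chain:
  assumes "smooth_atlas M A" "c \<in> A" "c' \<in> A" "c'' \<in> A"
    and "p \<in> chart_dom c" "p \<in> chart_dom c'" "p \<in> chart_dom c''"
  shows "transition_jacobian c c'' p = transition_jacobian c' c'' p ** transition_jacobian c c' p"
proof -
  note ch = smooth_atlas_is_chart[OF assms(1)]
  let ?S = "chart_map c ` (chart_dom c \<inter> chart_dom c')"
  have "(transition c' c'' has_derivative (\<lambda>h. transition_jacobian c' c'' p *v h)) (at (transition c c' (chart_map c p)))"
    using transition_has_derivative[OF assms(1,3,4,6,7)] transition_chart_map[OF ch[OF assms(2)] assms(5)] by simp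
  from has_derivative_compose[OF transition_has_derivative[OF assms(1,2,3,5,6)] this]
  have "((\<lambda>x. transition c' c'' (transition c c' x)) has_derivative
      (\<lambda>h. (transition_jacobian c' c'' p ** transition_jacobian c c' p) *v h)) (at (chart_map c p))"
    by (simp add: matrix_vector_mul_assoc)
  then have "(transition c c'' has_derivative
      (\<lambda>h. (transition_jacobian c' c'' p ** transition_jacobian c c' p) *v h)) (at (chart_map c p))"
  proof (rule has_derivative_transform_within_open[OF _ open_overlap[OF ch[OF assms(2)] ch[OF assms(3)]]])
    show "chart_map c p \<in> ?S" using assms by auto
    fix x assume "x \<in> ?S"
    then show "transition c' c'' (transition c c' x) = transition c c'' x"
      using chart_inv_chart_map[OF ch[OF assms(2)]] chart_inv_chart_map[OF ch[OF assms(3)]]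
      by (auto simp: transition_def)
  qed
  from has_derivative_unique[OF this transition_has_derivative[OF assms(1,2,4,5,7)]]
  show ?thesis by (metis matrix_eq)
qed

lemma transition_jacobian_self:
  assumes "smooth_atlas M A" "c \<in> A" "p \<in> chart_dom c"
  shows "transition_jacobian c c p = mat 1"
proof -
  note ch = smooth_atlas_is_chart[OF assms(1,2)]
  have "(transition c c has_derivative (\<lambda>h. h)) (at (chart_map c p))"
    by (rule has_derivative_transform_within_open[OF has_derivative_ident open_chart_img[OF ch]])
      (use assms(3) in \<open>auto simp: transition_def chart_map_chart_inv chart_map_in_img\<close>)
  from has_derivative_unique[OF this transition_has_derivative[OF assms(1,2,2,3,3)]]
  show ?thesis by (metis matrix_eq matrix_vector_mul_lid)
qed

lemma det_transition_jacobian_nonzero: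
  assumes "smooth_atlas M A" "c \<in> A" "c' \<in> A" "p \<in> chart_dom c" "p \<in> chart_dom c'"
  shows "det (transition_jacobian c c' p) \<noteq> 0"
proof -
  have "transition_jacobian c' c p ** transition_jacobian c c' p = mat 1"
    using transition_jacobian_chain[OF assms(1,2,3,2,4,5,4)] transition_jacobian_self[OF assms(1,2,4)] by simp
  then have "det (transition_jacobian c' c p) * det (transition_jacobian c c' p) = 1"
    by (metis det_I det_mul)
  then show ?thesis by auto
qed

section \<open>Differentials of functions on a manifold\<close>

text \<open>A pointwise version of differentiability that names the differential. It asks for a derivative in
every chart around the point, so that sums and local modifications need no reference to a particular chart. The predicate
\<open>GDERIV\<close> describes the derivative by its coefficient vector, which is how covector fields are given.\<close>

definition has_differential ::
    "('a, 'n::finite) chart set \<Rightarrow> ('a \<Rightarrow> real) \<Rightarrow> ('a, 'n) covector_field \<Rightarrow> 'a \<Rightarrow> bool"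
  where "has_differential A f \<omega> p \<longleftrightarrow>
    (\<forall>c\<in>A. p \<in> chart_dom c \<longrightarrow> GDERIV (in_coords c f) (chart_map c p) :> \<omega> c p)"

lemma has_differential_imp_differential:
  assumes "has_differential A f \<omega> p" "c \<in> A" "p \<in> chart_dom c"
  shows "differential f c p = \<omega> c p"
proof -
  have "GDERIV (in_coords c f) (chart_map c p) :> \<omega> c p"
    using assms by (simp add: has_differential_def)
  from GDERIV_imp_partial_deriv[OF this] show ?thesis
    by (simp add: differential_def vec_eq_iff)
qed

lemma has_differential_add:
  "has_differential A f \<omega> p \<Longrightarrow> has_differential A g \<eta> p \<Longrightarrow>
    has_differential A (\<lambda>q. f q + g q) (\<lambda>c q. \<omega> c q + \<eta> c q) p"
  unfolding has_differential_def in_coords_def o_def by (simp add: GDERIV_add)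

lemma has_differential_diff:
  "has_differential A f \<omega> p \<Longrightarrow> has_differential A g \<eta> p \<Longrightarrow>
    has_differential A (\<lambda>q. f q - g q) (\<lambda>c q. \<omega> c q - \<eta> c q) p"
  unfolding has_differential_def in_coords_def o_def by (simp add: GDERIV_diff)

lemma has_differential_const: "has_differential A (\<lambda>q. a) (\<lambda>c q. 0) p"
  unfolding has_differential_def in_coords_def o_def by (simp add: GDERIV_const)

text \<open>Differentials are local. The hypothesis is an equation on an open set of the manifold; it becomes
one on an open set of coordinates in each chart.\<close>

lemma has_differential_transform:
  assumes "smooth_atlas M A" "has_differential A f \<omega> p" "openin M W" "p \<in> W"
    and "\<And>q. q \<in> W \<Longrightarrow> f q = g q"
  shows "has_differential A g \<omega> p"
  unfolding has_differential_def
proof (intro ballI impI)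
  fix c assume c: "c \<in> A" "p \<in> chart_dom c"
  note ch = smooth_atlas_is_chart[OF assms(1) c(1)]
  show "GDERIV (in_coords c g) (chart_map c p) :> \<omega> c p"
  proof (rule GDERIV_transform_open[OF _ open_chart_image[OF ch assms(3)]])
    show "GDERIV (in_coords c f) (chart_map c p) :> \<omega> c p"
      using assms(2) c by (simp add: has_differential_def)
  qed (use assms(4,5) c ch in auto)
qed

lemma has_differential_eq_covector:
  assumes "has_differential A f \<omega> p" "\<And>c. c \<in> A \<Longrightarrow> p \<in> chart_dom c \<Longrightarrow> \<omega> c p = \<eta> c p"
  shows "has_differential A f \<eta> p"
  using assms by (simp add: has_differential_def)

text \<open>The chain rule for the transition map. Its transposed Jacobian appears because covectors
are represented by their coefficients.\<close>

lemma GDERIV_change_of_chart: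
  assumes "smooth_atlas M A" "c \<in> A" "c' \<in> A" "p \<in> chart_dom c" "p \<in> chart_dom c'"
    and "GDERIV (in_coords c' f) (chart_map c' p) :> D"
  shows "GDERIV (in_coords c f) (chart_map c p) :> transpose (transition_jacobian c c' p) *v D"
proof -
  note ch = smooth_atlas_is_chart[OF assms(1)]
  have "(in_coords c' f has_derivative (\<lambda>h. h \<bullet> D)) (at (transition c c' (chart_map c p)))"
    using assms(6) transition_chart_map[OF ch[OF assms(2)] assms(4)] by (simp add: gderiv_def)
  from has_derivative_compose[OF transition_has_derivative[OF assms(1-5)] this]
  have "GDERIV (\<lambda>x. in_coords c' f (transition c c' x)) (chart_map c p) :> transpose (transition_jacobian c c' p) *v D"
    unfolding gderiv_def by (simp add: dot_lmul_matrix inner_commute matrix_vector_mul_linear dot_matrix_vector_mul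
        flip: dot_lmul_matrix)
  then show ?thesis
    by (rule GDERIV_transform_open[OF _ open_overlap[OF ch[OF assms(2)] ch[OF assms(3)]]])
      (use assms(4,5) in_coords_transition[OF ch[OF assms(2)] ch[OF assms(3)]] in \<open>auto\<close>)
qed

text \<open>One chart suffices when the covector field obeys the transformation law at the point.\<close>

lemma has_differential_if_in_chart:
  assumes "smooth_atlas M A" "c' \<in> A" "p \<in> chart_dom c'"
    and "GDERIV (in_coords c' f) (chart_map c' p) :> \<omega> c' p"
    and "\<And>c. c \<in> A \<Longrightarrow> p \<in> chart_dom c \<Longrightarrow> \<omega> c p = transpose (transition_jacobian c c' p) *v \<omega> c' p"
  shows "has_differential A f \<omega> p"
  unfolding has_differential_def
  using GDERIV_change_of_chart[OF assms(1) _ assms(2) _ assms(3,4)] assms(5) by simp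

lemma Ck_function_has_differential:
  assumes "Ck_function (Suc k) A f"
  shows "has_differential A f (differential f) p"
  unfolding has_differential_def differential_def
  using assms[unfolded Ck_function_def]
  by (intro ballI impI Ck_on_imp_GDERIV[OF _ chart_map_in_img, where k=k]) (rule bspec)

lemma differential_change_of_chart:
  assumes "smooth_atlas M A" "c \<in> A" "c' \<in> A" "p \<in> chart_dom c" "p \<in> chart_dom c'"
    and "has_differential A f (differential f) p"
  shows "differential f c p = transpose (transition_jacobian c c' p) *v differential f c' p"
proof -
  have "GDERIV (in_coords c' f) (chart_map c' p) :> differential f c' p"
    using assms(3,5,6) by (simp add: has_differential_def)
  from GDERIV_imp_partial_deriv[OF GDERIV_change_of_chart[OF assms(1-5) this]]
  show ?thesis unfolding differential_def[of f c] by (simp add: vec_eq_iff)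
qed

lemma has_differential_imp_continuous_map:
  assumes "smooth_atlas M A" "\<And>p. p \<in> topspace M \<Longrightarrow> has_differential A f \<omega> p"
  shows "continuous_map M euclideanreal f"
  unfolding continuous_map_def
proof (intro conjI allI impI)
  fix V :: "real set" assume "openin euclideanreal V"
  then have "open V" by simp
  note ch = smooth_atlas_is_chart[OF assms(1)]
  let ?W = "\<lambda>c. {p \<in> chart_dom c. chart_map c p \<in> {x \<in> chart_img c. in_coords c f x \<in> V}}"
  have opn: "open {x \<in> chart_img c. in_coords c f x \<in> V}" if c: "c \<in> A" for c
  proof -
    have "isCont (in_coords c f) x" if "x \<in> chart_img c" for x
    proof -
      have "chart_inv c x \<in> topspace M"
        using chart_inv_in_dom[OF that] c smooth_atlas_topspace[OF assms(1)] by auto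
      then have "GDERIV (in_coords c f) (chart_map c (chart_inv c x)) :> \<omega> c (chart_inv c x)"
        using assms(2) c chart_inv_in_dom[OF that] unfolding has_differential_def by blast
      then show ?thesis
        unfolding gderiv_def chart_map_chart_inv[OF that] by (rule has_derivative_continuous)
    qed
    then have "continuous_on (chart_img c) (in_coords c f)"
      by (simp add: continuous_at_imp_continuous_on)
    from continuous_open_preimage[OF this open_chart_img[OF ch[OF c]] \<open>open V\<close>]
    show ?thesis by (simp add: vimage_def Int_def)
  qed
  have "openin M (?W c)" if "c \<in> A" for c
    by (rule openin_chart_vimage[OF ch[OF that] opn[OF that]])
  then have "openin M (\<Union>c\<in>A. ?W c)"
    by (intro openin_Union) (erule imageE, simp only:)
  also have "(\<Union>c\<in>A. ?W c) = {p \<in> topspace M. f p \<in> V}"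
    unfolding smooth_atlas_topspace[OF assms(1)]
    by (simp add: chart_map_in_img in_coords_chart_map[OF ch] set_eq_iff cong: conj_cong)
  finally show "openin M {p \<in> topspace M. f p \<in> V}" .
qed simp

lemma has_differential_zero_imp_locally_constant:
  assumes "smooth_atlas M A" "openin M V" "p \<in> V"
    and "\<And>q. q \<in> V \<Longrightarrow> has_differential A f (\<lambda>c q. 0) q"
  obtains W where "openin M W" "p \<in> W" "\<And>q. q \<in> W \<Longrightarrow> f q = f p"
proof -
  note ch = smooth_atlas_is_chart[OF assms(1)]
  obtain c where c: "c \<in> A" "p \<in> chart_dom c"
    using subsetD[OF openin_subset[OF assms(2)] assms(3)] smooth_atlas_topspace[OF assms(1)] by auto
  let ?x0 = "chart_map c p"
  let ?T = "chart_map c ` (chart_dom c \<inter> V)"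
  have "open ?T" "?x0 \<in> ?T"
    using open_chart_image[OF ch[OF c(1)] assms(2)] c(2) assms(3) by auto
  then obtain r where r: "r > 0" "ball ?x0 r \<subseteq> ?T"
    by (meson open_contains_ball)
  have der: "(in_coords c f has_derivative (\<lambda>h. 0)) (at x within ball ?x0 r)" if x: "x \<in> ball ?x0 r" for x
  proof -
    obtain q where q: "q \<in> chart_dom c" "q \<in> V" "x = chart_map c q" using subsetD[OF r(2) x] by blast
    then have "GDERIV (in_coords c f) x :> 0"
      using assms(4)[OF q(2)] c(1) by (simp add: has_differential_def)
    then show ?thesis by (auto simp: gderiv_def intro: has_derivative_at_withinI)
  qed
  show ?thesis
  proof (rule that)
    show "openin M {q \<in> chart_dom c. chart_map c q \<in> ball ?x0 r}"
      by (rule openin_chart_vimage[OF ch[OF c(1)]]) simp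
    show "p \<in> {q \<in> chart_dom c. chart_map c q \<in> ball ?x0 r}" using c(2) r(1) by simp
    fix q assume q: "q \<in> {q \<in> chart_dom c. chart_map c q \<in> ball ?x0 r}"
    have "in_coords c f (chart_map c q) = in_coords c f ?x0"
      by (rule has_derivative_zero_unique[OF convex_ball der]) (use q r(1) in auto)
    then show "f q = f p" using q c(2) by (simp add: in_coords_chart_map[OF ch[OF c(1)]])
  qed
qed

section \<open>Smooth functions and bump functions\<close>

lemma smooth_function_iff_Ck: "smooth_function A f \<longleftrightarrow> (\<forall>k. Ck_function k A f)"
  by (auto simp: smooth_function_def Ck_function_def smooth_on_def)

lemma smooth_function_has_differential:
  "smooth_function A f \<Longrightarrow> has_differential A f (differential f) p"
  by (rule Ck_function_has_differential[of 0]) (simp add: smooth_function_iff_Ck)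

lemma smooth_function_const: "smooth_atlas M A \<Longrightarrow> smooth_function A (\<lambda>q. a)"
  by (auto simp: smooth_function_def smooth_on_def in_coords_def o_def
      intro!: Ck_on_const open_chart_img dest: smooth_atlas_is_chart)

lemma smooth_function_sum:
  "smooth_atlas M A \<Longrightarrow> (\<And>i. i \<in> I \<Longrightarrow> smooth_function A (f i)) \<Longrightarrow> smooth_function A (\<lambda>q. \<Sum>i\<in>I. f i q)"
  by (auto simp: smooth_function_def smooth_on_def in_coords_def o_def
      intro!: Ck_on_sum open_chart_img dest: smooth_atlas_is_chart)

lemma smooth_function_mult:
  "smooth_atlas M A \<Longrightarrow> smooth_function A f \<Longrightarrow> smooth_function A g \<Longrightarrow> smooth_function A (\<lambda>q. f q * g q)"
  by (auto simp: smooth_function_def smooth_on_def in_coords_def o_def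
      intro!: Ck_on_mult open_chart_img dest: smooth_atlas_is_chart)

lemma smooth_function_inverse:
  assumes "smooth_atlas M A" "smooth_function A f" "\<And>p. p \<in> topspace M \<Longrightarrow> f p \<noteq> 0"
  shows "smooth_function A (\<lambda>q. inverse (f q))"
proof -
  have "f (chart_inv c x) \<noteq> 0" if "c \<in> A" "x \<in> chart_img c" for c x
    using assms(3) chart_inv_in_dom[OF that(2)] smooth_atlas_topspace[OF assms(1)] that(1) by auto
  then show ?thesis
    using assms(1,2) by (auto simp: smooth_function_def smooth_on_def in_coords_def o_def
      intro!: Ck_on_inverse open_chart_img dest: smooth_atlas_is_chart)
qed

text \<open>For \<open>n = 0\<close> this is Cauchy's smooth function that is flat at the origin. The factors \<open>t\<close> in the
denominator are included because the derivative of \<open>flat n\<close> is a combination of \<open>flat (n + 2)\<close> and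
\<open>flat (n + 1)\<close>, so that the family is closed under differentiation.\<close>

definition flat :: "nat \<Rightarrow> real \<Rightarrow> real"
  where "flat n t = (if t > 0 then exp (- (1 / t)) / t ^ n else 0)"

lemma flat_tendsto_0: "(flat n \<longlongrightarrow> 0) (at_right 0)"
proof -
  have "((\<lambda>s::real. s ^ n / exp s) \<longlongrightarrow> 0) at_top"
    by (rule tendsto_power_div_exp_0)
  then have "((\<lambda>t::real. inverse t ^ n / exp (inverse t)) \<longlongrightarrow> 0) (at_right 0)"
    by (simp add: filterlim_at_right_to_top)
  then show ?thesis
    by (rule Lim_transform_eventually)
      (auto simp: eventually_at_filter flat_def exp_minus field_simps power_inverse)
qed

lemma flat_has_real_derivative:
  "(flat n has_real_derivative flat (n + 2) t - n * flat (n + 1) t) (at t)"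
proof (cases t "0::real" rule: linorder_cases)
  case less
  have "((\<lambda>t. 0) has_real_derivative 0) (at t)" by simp
  then have "(flat n has_real_derivative 0) (at t)"
    by (rule has_field_derivative_transform_within_open[of _ _ _ "{..<0}"]) (use less in \<open>auto simp: flat_def\<close>)
  then show ?thesis using less by (simp add: flat_def)
next
  case equal
  have "((\<lambda>h. flat n h / h) \<longlongrightarrow> 0) (at_right 0)"
    by (rule Lim_transform_eventually[OF flat_tendsto_0[of "Suc n"]])
      (auto simp: eventually_at_filter flat_def)
  moreover have "((\<lambda>h. flat n h / h) \<longlongrightarrow> 0) (at_left 0)"
    by (rule Lim_transform_eventually[OF tendsto_const]) (auto simp: eventually_at_filter flat_def)
  ultimately have "((\<lambda>h. flat n h / h) \<longlongrightarrow> 0) (at 0)"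
    by (simp add: filterlim_at_split)
  then have "(flat n has_real_derivative 0) (at 0)"
    by (simp add: DERIV_def flat_def)
  then show ?thesis using equal by (simp add: flat_def)
next
  case greater
  have "((\<lambda>t. exp (- (1 / t)) / t ^ n) has_real_derivative
      (exp (- (1 / t)) * (1 / t\<^sup>2) * t ^ n - exp (- (1 / t)) * (n * t ^ (n - 1))) / (t ^ n * t ^ n)) (at t)"
    using greater by (auto intro!: derivative_eq_intros simp: power2_eq_square)
  also have "(exp (- (1 / t)) * (1 / t\<^sup>2) * t ^ n - exp (- (1 / t)) * (n * t ^ (n - 1))) / (t ^ n * t ^ n) =
      flat (n + 2) t - n * flat (n + 1) t"
    using greater by (cases n) (simp_all add: flat_def field_simps power2_eq_square)
  finally show ?thesis
    by (rule has_field_derivative_transform_within_open[of _ _ _ "{0<..}"]) (use greater in \<open>auto simp: flat_def\<close>)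
qed

lemma Ck_on_flat: "Ck_on k (flat n) UNIV"
proof (induction k arbitrary: n)
  case 0
  show ?case
    using flat_has_real_derivative[of n] by (auto intro!: DERIV_continuous_on)
next
  case (Suc k)
  show ?case
  proof (rule Ck_on_SucI)
    show "(flat n has_derivative (\<lambda>h. (flat (n + 2) t - n * flat (n + 1) t) * h)) (at t)" for t
      using flat_has_real_derivative[of n t] by (simp add: has_field_derivative_def)
    show "Ck_on k (\<lambda>t. (flat (n + 2) t - n * flat (n + 1) t) * b) UNIV" for b
      by (intro Ck_on_mult Ck_on_diff Ck_on_const Suc.IH) auto
  qed simp
qed

text \<open>In a chart, \<open>flat 0\<close> is composed with \<open>r\<^sup>2 - |x - x0|\<^sup>2\<close> for a closed ball inside the image of
\<open>U\<close>; outside the chart the function is 0. The result is smooth because every point lies either in the chart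
or in the complement of the preimage of the ball, and that complement is open: the preimage is
compact, hence closed in a Hausdorff space.\<close>

lemma exists_bump_function:
  assumes "smooth_atlas M A" "Hausdorff_space M" "openin M U" "p \<in> U"
  obtains \<beta> K where "smooth_function A \<beta>" "\<And>q. \<beta> q \<ge> 0" "\<beta> p > 0"
    "closedin M K" "K \<subseteq> U" "\<And>q. q \<notin> K \<Longrightarrow> \<beta> q = 0"
proof -
  note ch = smooth_atlas_is_chart[OF assms(1)]
  obtain c where c: "c \<in> A" "p \<in> chart_dom c"
    using subsetD[OF openin_subset[OF assms(3)] assms(4)] smooth_atlas_topspace[OF assms(1)] by auto
  let ?x0 = "chart_map c p"
  let ?V = "chart_map c ` (chart_dom c \<inter> U)"
  have "open ?V" "?x0 \<in> ?V"
    using open_chart_image[OF ch[OF c(1)] assms(3)] c(2) assms(4) by auto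
  then obtain r where r: "r > 0" "cball ?x0 r \<subseteq> ?V"
    by (meson open_contains_cball)
  define b where "b x = flat 0 (r\<^sup>2 - (x - ?x0) \<bullet> (x - ?x0))" for x
  define \<beta> where "\<beta> q = (if q \<in> chart_dom c then b (chart_map c q) else 0)" for q
  define K where "K = chart_inv c ` cball ?x0 r"
  have b: "Ck_on k b UNIV" for k
    unfolding b_def
    by (rule Ck_on_compose[OF _ _ Ck_on_flat])
      (auto intro!: Ck_on_diff Ck_on_const Ck_on_inner Ck_on_ident)
  have b0: "b x = 0" if "x \<notin> cball ?x0 r" for x
  proof -
    have "r < norm (x - ?x0)" using that by (simp add: dist_norm norm_minus_commute)
    then have "r\<^sup>2 < (norm (x - ?x0))\<^sup>2" using r(1) by (intro power_strict_mono) auto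
    then show ?thesis by (simp add: b_def flat_def power2_norm_eq_inner)
  qed
  have img: "cball ?x0 r \<subseteq> chart_img c" using r(2) by (auto simp: chart_img_def)
  show ?thesis
  proof (rule that)
    show "closedin M K"
      unfolding K_def
      by (rule compactin_imp_closedin[OF assms(2) compactin_chart_inv_image[OF ch[OF c(1)] _ img]]) simp
    show "K \<subseteq> U"
    proof
      fix q assume "q \<in> K"
      then obtain x where "x \<in> cball ?x0 r" "q = chart_inv c x" by (auto simp: K_def)
      then show "q \<in> U" using r(2) chart_inv_chart_map[OF ch[OF c(1)]] by auto
    qed
    show \<beta>0: "\<beta> q = 0" if "q \<notin> K" for q
    proof (cases "q \<in> chart_dom c")
      case True
      then have "chart_map c q \<notin> cball ?x0 r"
        using that chart_inv_chart_map[OF ch[OF c(1)] True] unfolding K_def by (metis imageI)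
      then show ?thesis by (simp add: \<beta>_def b0)
    qed (simp add: \<beta>_def)
    show "\<beta> q \<ge> 0" for q by (simp add: \<beta>_def b_def flat_def)
    show "\<beta> p > 0" using c(2) r(1) by (simp add: \<beta>_def b_def flat_def)
    have "Ck_on k (in_coords c' \<beta>) (chart_img c')" if c': "c' \<in> A" for c' k
    proof (rule Ck_on_local)
      fix x assume x: "x \<in> chart_img c'"
      let ?q = "chart_inv c' x"
      have q: "?q \<in> chart_dom c'" "chart_map c' ?q = x"
        using x by (auto simp: chart_inv_in_dom chart_map_chart_inv)
      show "\<exists>T. open T \<and> x \<in> T \<and> Ck_on k (in_coords c' \<beta>) T"
      proof (cases "?q \<in> chart_dom c")
        case True
        let ?T = "chart_map c' ` (chart_dom c' \<inter> chart_dom c)"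
        have T: "open ?T" by (rule open_overlap[OF ch[OF c'] ch[OF c(1)]])
        have "Ck_on k (\<lambda>y. b (transition c' c y)) ?T"
          by (rule Ck_on_compose[OF T _ b smooth_on_imp_Ck_on[OF smooth_on_transition[OF assms(1) c' c(1)]]]) auto
        then have "Ck_on k (in_coords c' \<beta>) ?T"
        proof (rule Ck_on_cong[OF T])
          fix y assume "y \<in> ?T"
          then show "b (transition c' c y) = in_coords c' \<beta> y"
            using chart_inv_chart_map[OF ch[OF c']] by (auto simp: transition_def in_coords_def \<beta>_def)
        qed
        moreover have "x \<in> ?T" using q True by (metis IntI imageI)
        ultimately show ?thesis using T by blast
      next
        case False
        let ?T = "chart_map c' ` (chart_dom c' \<inter> (topspace M - K))"
        have T: "open ?T"
          by (rule open_chart_image[OF ch[OF c']]) (use \<open>closedin M K\<close> in auto)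
        have "Ck_on k (in_coords c' \<beta>) ?T"
        proof (rule Ck_on_cong[OF T Ck_on_const[OF T, of k 0]])
          fix y assume "y \<in> ?T"
          then show "0 = in_coords c' \<beta> y"
            using chart_inv_chart_map[OF ch[OF c']] \<beta>0 by (auto simp: in_coords_def)
        qed
        moreover have "?q \<notin> K"
        proof
          assume "?q \<in> K"
          then obtain z where "z \<in> cball ?x0 r" "?q = chart_inv c z" unfolding K_def by (rule imageE)
          then show False using False img chart_inv_in_dom[of z c] by auto
        qed
        then have "?q \<in> chart_dom c' \<inter> (topspace M - K)"
          using q(1) smooth_atlas_topspace[OF assms(1)] c' by auto
        then have "x \<in> ?T" using q(2) by (metis imageI)
        ultimately show ?thesis using T by blast
      qed
    qed
    then show "smooth_function A \<beta>" by (simp add: smooth_function_def smooth_on_def)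
  qed
qed

section \<open>Locally exact covector fields and the first cohomology\<close>

text \<open>The functions \<open>\<psi>\<close> may differ from place to place: smoothness, the transformation law and closedness
of a form are local, and closedness is the symmetry of the second derivatives of \<open>\<psi>\<close>.\<close>

lemma locally_smooth_differential_imp_closed:
  fixes A :: "('a, 'b::finite) chart set"
  assumes "smooth_atlas M A"
    and "\<And>p. p \<in> topspace M \<Longrightarrow> \<exists>W \<psi>. openin M W \<and> p \<in> W \<and> smooth_function A \<psi> \<and>
      (\<forall>c\<in>A. \<forall>q\<in>W \<inter> chart_dom c. \<theta> c q = differential \<psi> c q)"
  shows "\<theta> \<in> closed_one_forms A"
proof -
  note ch = smooth_atlas_is_chart[OF assms(1)]
  have loc: "\<exists>T f. open T \<and> chart_map c p \<in> T \<and> T \<subseteq> chart_img c \<and> smooth_on f T \<and>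
      (\<forall>x\<in>T. in_coords c (\<theta> c) x = (\<chi> i. partial_deriv i f x))"
    if c: "c \<in> A" and p: "p \<in> chart_dom c" for c p
  proof -
    have "p \<in> topspace M" using c p smooth_atlas_topspace[OF assms(1)] by auto
    from assms(2)[OF this] obtain W \<psi> where W: "openin M W" "p \<in> W" "smooth_function A \<psi>"
      and eq: "\<forall>c\<in>A. \<forall>q\<in>W \<inter> chart_dom c. \<theta> c q = differential \<psi> c q"
      by (elim exE conjE)
    let ?T = "chart_map c ` (chart_dom c \<inter> W)"
    show ?thesis
    proof (intro exI conjI ballI)
      show "open ?T" by (rule open_chart_image[OF ch[OF c] W(1)])
      show "chart_map c p \<in> ?T" using p W(2) by auto
      show "?T \<subseteq> chart_img c" by (auto simp: chart_img_def)
      then show "smooth_on (in_coords c \<psi>) ?T"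
        using bspec[OF W(3)[unfolded smooth_function_def] c] Ck_on_subset
        unfolding smooth_on_def by blast
      show "in_coords c (\<theta> c) x = (\<chi> i. partial_deriv i (in_coords c \<psi>) x)" if "x \<in> ?T" for x
        using that bspec[OF eq c] by (auto simp: differential_def in_coords_chart_map[OF ch[OF c]])
    qed
  qed
  have "smooth_on (in_coords c (\<theta> c)) (chart_img c)" if c: "c \<in> A" for c
    unfolding smooth_on_def
  proof (intro allI Ck_on_local)
    fix k x assume "x \<in> chart_img c"
    then obtain p where "p \<in> chart_dom c" "x = chart_map c p" by (auto simp: chart_img_def)
    with loc[OF c] obtain T f where T: "open T" "x \<in> T" "smooth_on f T"
      "\<forall>x\<in>T. in_coords c (\<theta> c) x = (\<chi> i. partial_deriv i f x)" by blast
    have "Ck_on k (\<lambda>x. \<chi> i. partial_deriv i f x) T"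
      using Ck_on_imp_partial_deriv[OF smooth_on_imp_Ck_on[OF T(3)]]
      by (intro Ck_on_vec T(1)) simp
    then have "Ck_on k (in_coords c (\<theta> c)) T"
      by (rule Ck_on_cong[OF T(1)]) (use T(4) in simp)
    then show "\<exists>T. open T \<and> x \<in> T \<and> Ck_on k (in_coords c (\<theta> c)) T"
      by (intro exI[of _ T] conjI T(1,2))
  qed
  moreover have "\<theta> c p = transpose (transition_jacobian c c' p) *v \<theta> c' p"
    if c: "c \<in> A" "c' \<in> A" and p: "p \<in> chart_dom c" "p \<in> chart_dom c'" for c c' p
  proof -
    have "p \<in> topspace M" using c p smooth_atlas_topspace[OF assms(1)] by auto
    from assms(2)[OF this] obtain W \<psi> where W: "p \<in> W" "smooth_function A \<psi>"
      and "\<forall>c\<in>A. \<forall>q\<in>W \<inter> chart_dom c. \<theta> c q = differential \<psi> c q"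
      by (elim exE conjE)
    then have "\<theta> c p = differential \<psi> c p" "\<theta> c' p = differential \<psi> c' p"
      using c p W(1) by auto
    with differential_change_of_chart[OF assms(1) c p smooth_function_has_differential[OF W(2)]]
    show ?thesis by (simp only:)
  qed
  moreover have "exterior_deriv \<theta> c p = 0" if c: "c \<in> A" and p: "p \<in> chart_dom c" for c p
  proof -
    obtain T and f :: "real^'b \<Rightarrow> real" where T: "open T" "chart_map c p \<in> T" "smooth_on f T"
      "\<forall>x\<in>T. in_coords c (\<theta> c) x = (\<chi> i. partial_deriv i f x)" using loc[OF c p] by blast
    have "partial_deriv i (in_coords c (\<lambda>q. \<theta> c q $ j)) (chart_map c p) =
        partial_deriv i (partial_deriv j f) (chart_map c p)" for i j
    proof -
      have "in_coords c (\<lambda>q. \<theta> c q $ j) y = partial_deriv j f y" if "y \<in> T" for y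
        using bspec[OF T(4) that] by (simp add: in_coords_def)
      from frechet_derivative_transform_on(2)[OF T(1,2) this]
      show ?thesis unfolding partial_deriv_def[of i] by (rule fun_cong)
    qed
    moreover have "partial_deriv i (partial_deriv j f) (chart_map c p) =
        partial_deriv j (partial_deriv i f) (chart_map c p)" for i j
      by (rule partial_deriv_commute[OF T(1,2) smooth_on_imp_Ck_on[OF T(3)]])
    ultimately have "exterior_deriv \<theta> c p $ i $ j = 0" for i j
      unfolding exterior_deriv_def by simp
    then show ?thesis by (simp add: vec_eq_iff)
  qed
  ultimately show ?thesis
    unfolding closed_one_forms_def one_forms_def by blast
qed

text \<open>The class of a closed form contains the form itself since the zero form is exact; if the only class is
the set of exact forms, the form is exact.\<close>

lemma H1_vanishes_closed_imp_exact:
  assumes "smooth_atlas M A" "H1_vanishes A" "\<theta> \<in> closed_one_forms A"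
  shows "\<theta> \<in> exact_one_forms A"
proof -
  have zero: "differential (\<lambda>q. 0) c p = 0" if "c \<in> A" "p \<in> chart_dom c" for c p
    by (rule has_differential_imp_differential[OF has_differential_const that])
  have "(\<lambda>c p. 0) \<in> closed_one_forms A"
  proof (rule locally_smooth_differential_imp_closed[OF assms(1)], intro exI conjI)
    show "openin M (topspace M)" by simp
    show "smooth_function A (\<lambda>q. 0)" by (rule smooth_function_const[OF assms(1)])
  qed (use zero in auto)
  then have "(\<lambda>c p. \<theta> c p - \<theta> c p) \<in> exact_one_forms A"
    using zero smooth_function_const[OF assms(1), of 0]
    unfolding exact_one_forms_def closed_one_forms_def
    by (simp only: diff_self mem_Collect_eq) (intro conjI exI[of _ "\<lambda>q. 0"]; simp)
  then have "\<theta> \<in> cohomologous A `` {\<theta>}"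
    using assms(3) by (simp add: cohomologous_def)
  moreover have "cohomologous A `` {\<theta>} = exact_one_forms A"
    using assms(2,3) quotientI[of \<theta> "closed_one_forms A" "cohomologous A"]
    by (simp add: H1_vanishes_def de_Rham_H1_def)
  ultimately show ?thesis by simp
qed

text \<open>The passage from smooth forms to locally exact covector fields. Subtracting the differential of a partition-of-unity average \<open>\<Phi>\<close> of the
local primitives leaves a smooth closed form, because the differences of the local
primitives, which are all that remains, are locally constant.\<close>

lemma locally_exact_imp_exact:
  assumes M: "smooth_manifold M A" and "compact_space M" "H1_vanishes A"
    and loc: "\<And>p. p \<in> topspace M \<Longrightarrow>
      \<exists>U \<phi>. openin M U \<and> p \<in> U \<and> (\<forall>q\<in>U. has_differential A \<phi> \<eta> q)"
  shows "\<exists>F. \<forall>p\<in>topspace M. has_differential A F \<eta> p"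
proof -
  have atlas: "smooth_atlas M A" and H: "Hausdorff_space M"
    using M by (auto simp: smooth_manifold_def)
  from loc obtain U \<phi> where U: "\<And>p. p \<in> topspace M \<Longrightarrow> openin M (U p)" "\<And>p. p \<in> topspace M \<Longrightarrow> p \<in> U p"
    and \<phi>: "\<And>p q. p \<in> topspace M \<Longrightarrow> q \<in> U p \<Longrightarrow> has_differential A (\<phi> p) \<eta> q"
    by metis
  define bump where "bump \<beta> K p \<longleftrightarrow> smooth_function A \<beta> \<and> (\<forall>q. \<beta> q \<ge> 0) \<and> \<beta> p > 0 \<and>
    closedin M K \<and> K \<subseteq> U p \<and> (\<forall>q. q \<notin> K \<longrightarrow> \<beta> q = 0)" for \<beta> K p
  have "\<exists>\<beta> K. bump \<beta> K p" if p: "p \<in> topspace M" for p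
    by (rule exists_bump_function[OF atlas H U(1)[OF p] U(2)[OF p]]) (auto simp: bump_def)
  then obtain \<beta> K where "\<And>p. p \<in> topspace M \<Longrightarrow> bump (\<beta> p) (K p) p"
    by metis
  then have \<beta>: "\<And>p. p \<in> topspace M \<Longrightarrow> smooth_function A (\<beta> p)"
      "\<And>p q. p \<in> topspace M \<Longrightarrow> \<beta> p q \<ge> 0" "\<And>p. p \<in> topspace M \<Longrightarrow> \<beta> p p > 0"
    and K: "\<And>p. p \<in> topspace M \<Longrightarrow> closedin M (K p)" "\<And>p. p \<in> topspace M \<Longrightarrow> K p \<subseteq> U p"
      "\<And>p q. p \<in> topspace M \<Longrightarrow> q \<notin> K p \<Longrightarrow> \<beta> p q = 0"
    by (simp_all add: bump_def)
  define O' where "O' p = {q \<in> topspace M. \<beta> p q \<in> {0<..}}" for p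
  have O': "openin M (O' p)" if "p \<in> topspace M" for p
  proof -
    have "continuous_map M euclideanreal (\<beta> p)"
      using has_differential_imp_continuous_map[OF atlas smooth_function_has_differential[OF \<beta>(1)[OF that]]] .
    then show ?thesis unfolding O'_def by (rule openin_continuous_map_preimage) simp
  qed
  have "topspace M \<subseteq> \<Union> (O' ` topspace M)" using \<beta>(3) by (auto simp: O'_def)
  moreover have "compactin M (topspace M)" using assms(2) by (simp add: compact_space_def)
  moreover have "openin M V" if "V \<in> O' ` topspace M" for V
    using that O' by auto
  ultimately obtain \<F> where \<F>: "finite \<F>" "\<F> \<subseteq> O' ` topspace M" "topspace M \<subseteq> \<Union>\<F>"
    using compactinD[of M "topspace M" "O' ` topspace M"] by auto
  obtain S where S: "S \<subseteq> topspace M" "finite S" "\<F> = O' ` S"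
    using finite_subset_image[OF \<F>(1,2)] by blast
  then have S: "finite S" "S \<subseteq> topspace M" "topspace M \<subseteq> \<Union> (O' ` S)"
    using \<F>(3) by simp_all
  define s where "s q = (\<Sum>p\<in>S. \<beta> p q)" for q
  have s: "s q > 0" if q: "q \<in> topspace M" for q
  proof -
    obtain p where p: "p \<in> S" "\<beta> p q > 0" using S(3) q by (auto simp: O'_def)
    then show ?thesis
      unfolding s_def using S(1,2) \<beta>(2) by (intro sum_pos2[of S p]) auto
  qed
  define \<rho> where "\<rho> p q = \<beta> p q * inverse (s q)" for p q
  have s_smooth: "smooth_function A s"
    unfolding s_def using \<beta>(1) S(2) by (intro smooth_function_sum[OF atlas]) auto
  have \<rho>_smooth: "smooth_function A (\<rho> p)" if "p \<in> S" for p
    unfolding \<rho>_def using that S(2) s \<beta>(1)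
    by (intro smooth_function_mult[OF atlas] smooth_function_inverse[OF atlas s_smooth]) (auto simp: less_imp_neq[symmetric])
  have \<rho>_sum: "(\<Sum>p\<in>S. \<rho> p q) = 1" if "q \<in> topspace M" for q
    using s[OF that] unfolding \<rho>_def by (simp flip: sum_distrib_right s_def)
  \<comment> \<open>As \<open>\<rho> p\<close> vanishes near the complement of \<open>U p\<close>, the values of \<open>\<phi> p\<close> outside \<open>U p\<close> do no harm.\<close>
  define \<Phi> where "\<Phi> q = (\<Sum>p\<in>S. \<rho> p q * \<phi> p q)" for q
  have *: "\<exists>W \<psi>. openin M W \<and> q0 \<in> W \<and> smooth_function A \<psi> \<and>
      (\<forall>q\<in>W. has_differential A \<Phi> (\<lambda>c q. \<eta> c q - differential \<psi> c q) q)"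
    if q0: "q0 \<in> topspace M" for q0
  proof -
    \<comment> \<open>Either \<open>\<phi> q0\<close> and \<open>\<phi> p\<close> are both primitives of \<open>\<eta>\<close> near \<open>q0\<close>, or \<open>\<rho> p\<close> vanishes there.\<close>
    have "\<exists>W a. openin M W \<and> q0 \<in> W \<and> (\<forall>q\<in>W. \<rho> p q * (\<phi> q0 q - \<phi> p q) = a * \<rho> p q)" if p: "p \<in> S" for p
    proof (cases "q0 \<in> U p")
      case True
      have pM: "p \<in> topspace M" using p S(2) by auto
      have "has_differential A (\<lambda>q. \<phi> q0 q - \<phi> p q) (\<lambda>c q. 0) q" if "q \<in> U q0 \<inter> U p" for q
        using has_differential_diff[OF \<phi>[OF q0, of q] \<phi>[OF pM, of q]] that by simp
      moreover have "q0 \<in> U q0 \<inter> U p" using U(2)[OF q0] True by simp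
      ultimately obtain W where W: "openin M W" "q0 \<in> W" "\<And>q. q \<in> W \<Longrightarrow> \<phi> q0 q - \<phi> p q = \<phi> q0 q0 - \<phi> p q0"
        using has_differential_zero_imp_locally_constant[OF atlas openin_Int[OF U(1)[OF q0] U(1)[OF pM]],
            of q0 "\<lambda>q. \<phi> q0 q - \<phi> p q"] by blast
      have "\<rho> p q * (\<phi> q0 q - \<phi> p q) = (\<phi> q0 q0 - \<phi> p q0) * \<rho> p q" if "q \<in> W" for q
        unfolding W(3)[OF that] by (rule mult.commute)
      with W(1,2) show ?thesis by (intro exI[of _ W] exI[of _ "\<phi> q0 q0 - \<phi> p q0"] conjI ballI)
    next
      case False
      have pM: "p \<in> topspace M" using p S(2) by auto
      show ?thesis
        by (intro exI[of _ "topspace M - K p"] exI[of _ 0])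
          (use K[OF pM] False q0 in \<open>auto simp: \<rho>_def\<close>)
    qed
    then obtain W a where W: "\<And>p. p \<in> S \<Longrightarrow> openin M (W p)" "\<And>p. p \<in> S \<Longrightarrow> q0 \<in> W p"
      and a: "\<And>p q. p \<in> S \<Longrightarrow> q \<in> W p \<Longrightarrow> \<rho> p q * (\<phi> q0 q - \<phi> p q) = a p * \<rho> p q"
      by metis
    \<comment> \<open>Near \<open>q0\<close> this is \<open>\<phi> q0 - \<Phi>\<close>, and it is smooth on the whole manifold.\<close>
    define \<psi> where "\<psi> q = (\<Sum>p\<in>S. a p * \<rho> p q)" for q
    define N where "N = U q0 \<inter> ((\<Inter>p\<in>S. W p) \<inter> topspace M)"
    have N: "openin M N" "q0 \<in> N"
      unfolding N_def using W U q0 S(1) by (auto intro!: openin_Int[OF U(1)[OF q0] openin_INT])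
    have \<psi>_smooth: "smooth_function A \<psi>"
      unfolding \<psi>_def by (intro smooth_function_sum[OF atlas] smooth_function_mult[OF atlas] smooth_function_const[OF atlas] \<rho>_smooth)
    have eq: "\<phi> q0 q - \<psi> q = \<Phi> q" if q: "q \<in> N" for q
    proof -
      have "\<psi> q = (\<Sum>p\<in>S. \<rho> p q * (\<phi> q0 q - \<phi> p q))"
        unfolding \<psi>_def by (intro sum.cong refl a[symmetric]) (use q in \<open>auto simp: N_def\<close>)
      also have "\<dots> = (\<Sum>p\<in>S. \<rho> p q) * \<phi> q0 q - \<Phi> q"
        unfolding \<Phi>_def by (simp add: right_diff_distrib sum_subtractf sum_distrib_right)
      finally show ?thesis using \<rho>_sum q by (simp add: N_def)
    qed
    have "has_differential A \<Phi> (\<lambda>c q. \<eta> c q - differential \<psi> c q) q" if q: "q \<in> N" for q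
    proof (rule has_differential_transform[OF atlas _ N(1) q eq])
      show "has_differential A (\<lambda>q. \<phi> q0 q - \<psi> q) (\<lambda>c q. \<eta> c q - differential \<psi> c q) q"
        using q by (intro has_differential_diff \<phi>[OF q0] smooth_function_has_differential[OF \<psi>_smooth]) (simp add: N_def)
    qed
    with N \<psi>_smooth show ?thesis by (intro exI[of _ N] exI[of _ \<psi>]) simp
  qed
  define \<theta> where "\<theta> c q = \<eta> c q - differential \<Phi> c q" for c q
  have "\<theta> \<in> closed_one_forms A"
  proof (rule locally_smooth_differential_imp_closed[OF atlas])
    fix p assume "p \<in> topspace M"
    from *[OF this] obtain W \<psi> where W: "openin M W" "p \<in> W" "smooth_function A \<psi>"
      and d: "\<forall>q\<in>W. has_differential A \<Phi> (\<lambda>c q. \<eta> c q - differential \<psi> c q) q"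
      by (elim exE conjE)
    have "\<theta> c q = differential \<psi> c q" if "c \<in> A" "q \<in> W \<inter> chart_dom c" for c q
      unfolding \<theta>_def
      using has_differential_imp_differential[OF bspec[OF d, of q] that(1)] that(2) by simp
    with W show "\<exists>W \<psi>. openin M W \<and> p \<in> W \<and> smooth_function A \<psi> \<and>
        (\<forall>c\<in>A. \<forall>q\<in>W \<inter> chart_dom c. \<theta> c q = differential \<psi> c q)"
      by (intro exI[of _ W] exI[of _ \<psi>]) simp
  qed
  from H1_vanishes_closed_imp_exact[OF atlas assms(3) this]
  obtain h where h: "smooth_function A h" "\<And>c q. c \<in> A \<Longrightarrow> q \<in> chart_dom c \<Longrightarrow> \<theta> c q = differential h c q"
    by (auto simp: exact_one_forms_def)
  have "has_differential A (\<lambda>q. \<Phi> q + h q) \<eta> p" if p: "p \<in> topspace M" for p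
  proof -
    from *[OF p] obtain \<psi> where d: "has_differential A \<Phi> (\<lambda>c q. \<eta> c q - differential \<psi> c q) p"
      by auto
    have "has_differential A \<Phi> (differential \<Phi>) p"
      by (rule has_differential_eq_covector[OF d]) (use has_differential_imp_differential[OF d] in simp)
    from has_differential_add[OF this smooth_function_has_differential[OF h(1)]]
    show ?thesis
    proof (rule has_differential_eq_covector)
      fix c assume "c \<in> A" "p \<in> chart_dom c"
      from h(2)[OF this, symmetric] show "differential \<Phi> c p + differential h c p = \<eta> c p"
        by (simp only: \<theta>_def) simp
    qed
  qed
  then show ?thesis by blast
qed

section \<open>Orientation signs of charts\<close>

lemma continuous_on_det:
  fixes f :: "'a::topological_space \<Rightarrow> real^'n^'n"
  assumes "\<And>i j. continuous_on S (\<lambda>x. f x $ i $ j)"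
  shows "continuous_on S (\<lambda>x. det (f x))"
  unfolding det_def by (intro continuous_intros assms)

lemma sgn_locally_constant:
  fixes f :: "'a::topological_space \<Rightarrow> real"
  assumes "open S" "continuous_on S f" "x \<in> S" "f x \<noteq> 0"
  obtains T where "open T" "x \<in> T" "T \<subseteq> S" "\<And>y. y \<in> T \<Longrightarrow> sgn (f y) = sgn (f x)"
proof (rule that)
  let ?T = "{y \<in> S. 0 < f y * f x}"
  have "open (S \<inter> (\<lambda>y. f y * f x) -` {0<..})"
    by (intro continuous_open_preimage continuous_intros assms)
  also have "S \<inter> (\<lambda>y. f y * f x) -` {0<..} = ?T" by auto
  finally show "open ?T" .
  show "x \<in> ?T" using assms(3,4) by (auto simp: zero_less_mult_iff)
  show "sgn (f y) = sgn (f x)" if "y \<in> ?T" for y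
    using that by (auto simp: zero_less_mult_iff)
qed auto

text \<open>The determinant is continuous and never zero.\<close>

lemma det_transition_jacobian_sgn_locally_constant:
  assumes "smooth_atlas M A" "c \<in> A" "c' \<in> A" "p \<in> chart_dom c" "p \<in> chart_dom c'"
  obtains W where "openin M W" "p \<in> W" "W \<subseteq> chart_dom c \<inter> chart_dom c'"
    "\<And>q. q \<in> W \<Longrightarrow> sgn (det (transition_jacobian c c' q)) = sgn (det (transition_jacobian c c' p))"
proof -
  note ch = smooth_atlas_is_chart[OF assms(1)]
  let ?S = "chart_map c ` (chart_dom c \<inter> chart_dom c')"
  let ?f = "\<lambda>x. det (jacobian (transition c c') (at x))"
  have S: "open ?S" by (rule open_overlap[OF ch[OF assms(2)] ch[OF assms(3)]])
  have "Ck_on (Suc 0) (transition c c') ?S"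
    using smooth_on_transition[OF assms(1-3)] by (rule smooth_on_imp_Ck_on)
  then have "continuous_on ?S (\<lambda>x. frechet_derivative (transition c c') (at x) (axis j 1))" for j
    by (simp add: axis_in_Basis_iff)
  then have "continuous_on ?S ?f"
    by (intro continuous_on_det) (auto simp: jacobian_def matrix_def intro!: continuous_intros)
  moreover have "?f (chart_map c p) \<noteq> 0"
    using det_transition_jacobian_nonzero[OF assms] by (simp add: transition_jacobian_def)
  moreover have "chart_map c p \<in> ?S" using assms by auto
  ultimately obtain T where T: "open T" "chart_map c p \<in> T" "T \<subseteq> ?S"
    "\<And>y. y \<in> T \<Longrightarrow> sgn (?f y) = sgn (?f (chart_map c p))"
    using sgn_locally_constant[OF S, of ?f "chart_map c p"] by blast
  show ?thesis
  proof (rule that)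
    show "openin M ({q \<in> chart_dom c. chart_map c q \<in> T} \<inter> chart_dom c')"
      by (intro openin_Int openin_chart_vimage ch assms T(1) openin_chart_dom)
    show "p \<in> {q \<in> chart_dom c. chart_map c q \<in> T} \<inter> chart_dom c'" using assms T(2) by simp
    show "sgn (det (transition_jacobian c c' q)) = sgn (det (transition_jacobian c c' p))"
      if "q \<in> {q \<in> chart_dom c. chart_map c q \<in> T} \<inter> chart_dom c'" for q
      using T(4)[of "chart_map c q"] that by (simp add: transition_jacobian_def)
  qed auto
qed

text \<open>\<open>\<sigma> c p\<close> tells whether the chart \<open>c\<close> of the given atlas agrees at \<open>p\<close> with the orientation. It
is the sign of the Jacobian determinant of the change from \<open>c\<close> to a chart of the oriented
atlas; by the chain rule it does not matter to which one, so near \<open>p\<close> a fixed one can be used.\<close>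

lemma orientable_imp_orientation_signs:
  assumes "smooth_atlas M A" "orientable M A"
  obtains \<sigma> where
    "\<And>c p. c \<in> A \<Longrightarrow> p \<in> chart_dom c \<Longrightarrow> \<sigma> c p \<in> {1, -1::real}"
    "\<And>c p. c \<in> A \<Longrightarrow> p \<in> chart_dom c \<Longrightarrow>
      \<exists>W. openin M W \<and> p \<in> W \<and> W \<subseteq> chart_dom c \<and> (\<forall>q\<in>W. \<sigma> c q = \<sigma> c p)"
    "\<And>c c' p. c \<in> A \<Longrightarrow> c' \<in> A \<Longrightarrow> p \<in> chart_dom c \<Longrightarrow> p \<in> chart_dom c' \<Longrightarrow>
      sgn (det (transition_jacobian c c' p)) = \<sigma> c p * \<sigma> c' p"
proof -
  obtain B where B: "smooth_atlas M B" "smooth_atlas M (A \<union> B)"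
    and pos: "\<And>b b' p. b \<in> B \<Longrightarrow> b' \<in> B \<Longrightarrow> p \<in> chart_dom b \<Longrightarrow> p \<in> chart_dom b' \<Longrightarrow>
      det (transition_jacobian b b' p) > 0"
    using assms(2) unfolding orientable_def by auto
  define \<beta> where "\<beta> p = (SOME b. b \<in> B \<and> p \<in> chart_dom b)" for p
  have \<beta>: "\<beta> p \<in> B" "p \<in> chart_dom (\<beta> p)" if "c \<in> A" "p \<in> chart_dom c" for c p
  proof -
    have "p \<in> topspace M" using smooth_atlas_topspace[OF assms(1)] that by auto
    then have "\<exists>b. b \<in> B \<and> p \<in> chart_dom b" using smooth_atlas_topspace[OF B(1)] by auto
    from someI_ex[OF this] show "\<beta> p \<in> B" "p \<in> chart_dom (\<beta> p)" by (simp_all add: \<beta>_def)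
  qed
  define \<sigma> where "\<sigma> c p = sgn (det (transition_jacobian c (\<beta> p) p))" for c p
  have eq: "\<sigma> c p = sgn (det (transition_jacobian c b p))"
    if "c \<in> A" "b \<in> B" "p \<in> chart_dom c" "p \<in> chart_dom b" for c b p
  proof -
    note b = \<beta>[OF that(1,3)]
    have "det (transition_jacobian c b p) =
        det (transition_jacobian (\<beta> p) b p) * det (transition_jacobian c (\<beta> p) p)"
      using transition_jacobian_chain[OF B(2), of c "\<beta> p" b p] that b by (simp add: det_mul)
    then show ?thesis
      using pos[OF b(1) that(2) b(2) that(4)] by (simp add: \<sigma>_def sgn_mult)
  qed
  show ?thesis
  proof (rule that)
    fix c p assume c: "c \<in> A" "p \<in> chart_dom c"
    note b = \<beta>[OF c]
    have "det (transition_jacobian c (\<beta> p) p) \<noteq> 0"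
      using det_transition_jacobian_nonzero[OF B(2)] b c by simp
    then show "\<sigma> c p \<in> {1, -1}" by (simp add: \<sigma>_def sgn_if)
    obtain W where W: "openin M W" "p \<in> W" "W \<subseteq> chart_dom c \<inter> chart_dom (\<beta> p)"
      "\<And>q. q \<in> W \<Longrightarrow> sgn (det (transition_jacobian c (\<beta> p) q)) = sgn (det (transition_jacobian c (\<beta> p) p))"
      using det_transition_jacobian_sgn_locally_constant[OF B(2), of c "\<beta> p" p] b c by auto
    have "\<sigma> c q = \<sigma> c p" if q: "q \<in> W" for q
    proof -
      have "q \<in> chart_dom c" "q \<in> chart_dom (\<beta> p)" using W(3) q by auto
      from eq[OF c(1) b(1) this] show ?thesis
        by (simp only: W(4)[OF q] \<sigma>_def)
    qed
    moreover have "W \<subseteq> chart_dom c" using W(3) by blast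
    ultimately show "\<exists>W. openin M W \<and> p \<in> W \<and> W \<subseteq> chart_dom c \<and> (\<forall>q\<in>W. \<sigma> c q = \<sigma> c p)"
      using W(1,2) by blast
  next
    fix c c' p assume c: "c \<in> A" "c' \<in> A" "p \<in> chart_dom c" "p \<in> chart_dom c'"
    note b = \<beta>[OF c(1,3)]
    have "det (transition_jacobian c (\<beta> p) p) =
        det (transition_jacobian c' (\<beta> p) p) * det (transition_jacobian c c' p)"
      using transition_jacobian_chain[OF B(2), of c c' "\<beta> p" p] c b by (simp add: det_mul)
    moreover have "det (transition_jacobian c' (\<beta> p) p) \<noteq> 0"
      using det_transition_jacobian_nonzero[OF B(2)] b c by simp
    ultimately show "sgn (det (transition_jacobian c c' p)) = \<sigma> c p * \<sigma> c' p"
      by (simp add: \<sigma>_def sgn_mult)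
  qed
qed

section \<open>The quarter turn of the plane\<close>

text \<open>Rotation by 90 degrees. It turns vector densities into 1-forms, and divergence-free ones into closed ones.\<close>

definition rot90 :: "real^2 \<Rightarrow> real^2"
  where "rot90 y = vector [- (y $ 2), y $ 1]"

lemma rot90_nth [simp]: "rot90 y $ 1 = - (y $ 2)" "rot90 y $ 2 = y $ 1"
  by (simp_all add: rot90_def)

lemma inner_real_2: "(x::real^2) \<bullet> y = x $ 1 * y $ 1 + x $ 2 * y $ 2"
  by (simp add: inner_vec_def sum_2)

lemma linear_rot90: "linear rot90"
  by (rule linearI) (simp_all add: vec_eq_iff forall_2)

lemma bounded_linear_rot90: "bounded_linear rot90"
  using linear_rot90 by (simp add: linear_conv_bounded_linear)

lemma rot90_scaleR: "rot90 (a *\<^sub>R x) = a *\<^sub>R rot90 x"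
  by (simp add: vec_eq_iff forall_2)

lemma rot90_diff: "rot90 (x - y) = rot90 x - rot90 y"
  by (simp add: vec_eq_iff forall_2)

lemma rot90_inner_rot90: "rot90 x \<bullet> rot90 y = x \<bullet> y"
  by (simp add: inner_real_2)

lemma rot90_inner_self: "rot90 x \<bullet> x = 0"
  by (simp add: inner_real_2)

text \<open>The cofactor identity for \<open>2 \<times> 2\<close> matrices, written without inverses.\<close>

lemma transpose_mult_rot90: "transpose J *v rot90 (J *v y) = det J *\<^sub>R rot90 y"
  by (simp add: vec_eq_iff forall_2 matrix_vector_mult_def transpose_def sum_2 det_2 algebra_simps)

text \<open>Applied to the derivative \<open>L\<close> of a plane vector field: if the field has divergence 0, then its
quarter turn has a symmetric derivative and so satisfies the hypothesis of the Poincare lemma.\<close>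

lemma trace_zero_imp_rot90_symmetric:
  fixes L :: "real^2 \<Rightarrow> real^2"
  assumes "linear L" "(\<Sum>i\<in>UNIV. L (axis i 1) $ i) = 0"
  shows "rot90 (L h) \<bullet> k = rot90 (L k) \<bullet> h"
proof -
  have e: "L z = z $ 1 *\<^sub>R L (axis 1 1) + z $ 2 *\<^sub>R L (axis 2 1)" for z
  proof -
    have "z = z $ 1 *\<^sub>R axis 1 1 + z $ 2 *\<^sub>R axis 2 1"
      by (simp add: vec_eq_iff forall_2 axis_def)
    then have "L z = L (z $ 1 *\<^sub>R axis 1 1 + z $ 2 *\<^sub>R axis 2 1)" by (rule arg_cong)
    then show ?thesis by (simp only: linear_add[OF assms(1)] linear_cmul[OF assms(1)])
  qed
  have tr: "L (axis 2 1) $ 2 = - L (axis 1 1) $ 1" using assms(2) by (simp add: sum_2)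
  show ?thesis
    unfolding e[of h] e[of k] by (simp add: inner_real_2 tr algebra_simps)
qed

section \<open>Riemannian metrics in dimension two and the flux of a function\<close>

lemma matrix_inv_inverse:
  assumes "invertible A"
  shows "A ** matrix_inv A = mat 1" "matrix_inv A ** A = mat 1"
  using someI_ex[of "\<lambda>A'. A ** A' = mat 1 \<and> A' ** A = mat 1"] assms
  unfolding matrix_inv_def invertible_def by auto

lemma matrix_inv_2:
  fixes G :: "real^2^2"
  assumes "det G \<noteq> 0"
  shows "matrix_inv G $ 1 $ 1 = G $ 2 $ 2 * inverse (det G)"
    "matrix_inv G $ 1 $ 2 = - G $ 1 $ 2 * inverse (det G)"
    "matrix_inv G $ 2 $ 1 = - G $ 2 $ 1 * inverse (det G)"
    "matrix_inv G $ 2 $ 2 = G $ 1 $ 1 * inverse (det G)"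
proof -
  define B where "B = matrix_inv G"
  have "invertible G" using assms by (simp add: invertible_det_nz)
  then have "G ** B = mat 1" unfolding B_def by (rule matrix_inv_inverse)
  then have e: "G $ 1 $ 1 * B $ 1 $ 1 + G $ 1 $ 2 * B $ 2 $ 1 = 1"
    "G $ 1 $ 1 * B $ 1 $ 2 + G $ 1 $ 2 * B $ 2 $ 2 = 0"
    "G $ 2 $ 1 * B $ 1 $ 1 + G $ 2 $ 2 * B $ 2 $ 1 = 0"
    "G $ 2 $ 1 * B $ 1 $ 2 + G $ 2 $ 2 * B $ 2 $ 2 = 1"
    by (simp_all add: matrix_matrix_mult_def vec_eq_iff forall_2 sum_2 mat_def)
  have "B $ 1 $ 1 * det G = G $ 2 $ 2" "B $ 1 $ 2 * det G = - G $ 1 $ 2"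
    "B $ 2 $ 1 * det G = - G $ 2 $ 1" "B $ 2 $ 2 * det G = G $ 1 $ 1"
    using e unfolding det_2 by algebra+
  then show "matrix_inv G $ 1 $ 1 = G $ 2 $ 2 * inverse (det G)"
    "matrix_inv G $ 1 $ 2 = - G $ 1 $ 2 * inverse (det G)"
    "matrix_inv G $ 2 $ 1 = - G $ 2 $ 1 * inverse (det G)"
    "matrix_inv G $ 2 $ 2 = G $ 1 $ 1 * inverse (det G)"
    using assms unfolding B_def by (simp_all add: field_simps)
qed

lemma riemannian_metric_symmetric:
  "riemannian_metric A g \<Longrightarrow> c \<in> A \<Longrightarrow> p \<in> chart_dom c \<Longrightarrow> transpose (g c p) = g c p"
  unfolding riemannian_metric_def by blast

lemma riemannian_metric_positive:
  assumes "riemannian_metric A g" "c \<in> A" "p \<in> chart_dom c" "\<xi> \<noteq> 0"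
  shows "\<xi> \<bullet> (g c p *v \<xi>) > 0"
  using assms(1)[unfolded riemannian_metric_def, THEN conjunct2, THEN conjunct1] assms(2-) by blast

lemma riemannian_metric_change_of_chart:
  assumes "riemannian_metric A g" "c \<in> A" "c' \<in> A" "p \<in> chart_dom c" "p \<in> chart_dom c'"
  shows "g c p = transpose (transition_jacobian c c' p) ** g c' p ** transition_jacobian c c' p"
  using assms(1)[unfolded riemannian_metric_def, THEN conjunct2, THEN conjunct2, rule_format, of c c' p]
    assms(2-) by blast

text \<open>The quadratic form takes the value \<open>g\<^sub>1\<^sub>1\<close> at \<open>(1, 0)\<close> and
\<open>g\<^sub>1\<^sub>1 det g\<close> at \<open>(- g\<^sub>1\<^sub>2, g\<^sub>1\<^sub>1)\<close>.\<close>

lemma riemannian_metric_det_pos: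
  fixes g :: "('a, 2) metric"
  assumes "riemannian_metric A g" "c \<in> A" "p \<in> chart_dom c"
  shows "det (g c p) > 0"
proof -
  let ?G = "g c p"
  have t: "transpose ?G = ?G" and pos: "\<And>\<xi>. \<xi> \<noteq> 0 \<Longrightarrow> \<xi> \<bullet> (?G *v \<xi>) > 0"
    using riemannian_metric_symmetric[OF assms] riemannian_metric_positive[OF assms] by auto
  have "transpose ?G $ 1 $ 2 = ?G $ 1 $ 2" by (simp only: t)
  then have s: "?G $ 1 $ 2 = ?G $ 2 $ 1" by (simp only: transpose_def vec_lambda_beta)
  have a: "?G $ 1 $ 1 > 0"
    using pos[of "axis 1 1"] by (simp add: inner_real_2 matrix_vector_mult_def sum_2 axis_def vec_eq_iff)
  let ?\<xi> = "vector [- ?G $ 1 $ 2, ?G $ 1 $ 1] :: real^2"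
  have "?\<xi> \<noteq> 0" using a by (auto simp: vec_eq_iff forall_2)
  from pos[OF this] have "?G $ 1 $ 1 * det ?G > 0"
    by (simp add: inner_real_2 matrix_vector_mult_def sum_2 det_2 s algebra_simps)
  then show ?thesis using a by (simp add: zero_less_mult_iff)
qed

text \<open>The gradient of \<open>u\<close> times the Riemannian density: the vector whose coordinate
divergence is \<open>sqrt |g| \<Delta>u\<close>. It has the type of a covector field because both are coefficient vectors in a
chart, but it transforms as a vector density; its quarter turn is a covector field up to signs.\<close>

definition flux :: "('a, 2) metric \<Rightarrow> ('a \<Rightarrow> real) \<Rightarrow> ('a, 2) covector_field"
  where "flux g u c p = sqrt (det (g c p)) *\<^sub>R (matrix_inv (g c p) *v differential u c p)"

text \<open>This form of the definition avoids the inverse matrix and is the one used to change charts.\<close>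

lemma metric_mult_flux:
  assumes "riemannian_metric A g" "c \<in> A" "p \<in> chart_dom c"
  shows "g c p *v flux g u c p = sqrt (det (g c p)) *\<^sub>R differential u c p"
proof -
  have "invertible (g c p)"
    using riemannian_metric_det_pos[OF assms] by (simp add: invertible_det_nz)
  from matrix_inv_inverse(1)[OF this] show ?thesis
    by (simp add: flux_def matrix_vector_mult_scaleR matrix_vector_mul_assoc)
qed

text \<open>The quarter turn of the flux is \<open>* du\<close> in an oriented chart, so it must transform as a covector up to
the sign of the orientation change. With \<open>J\<close> the Jacobian, the flux satisfies
\<open>J flux = |det J| flux'\<close>, and the cofactor identity moves the quarter turn past \<open>J\<close>.\<close>

lemma rot90_flux_change_of_chart:
  assumes atlas: "smooth_atlas M A" and g: "riemannian_metric A g"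
    and c: "c \<in> A" "c' \<in> A" "p \<in> chart_dom c" "p \<in> chart_dom c'"
    and u: "has_differential A u (differential u) p"
  shows "rot90 (flux g u c p) = sgn (det (transition_jacobian c c' p)) *\<^sub>R
    (transpose (transition_jacobian c c' p) *v rot90 (flux g u c' p))"
proof -
  let ?J = "transition_jacobian c c' p"
  let ?K = "transition_jacobian c' c p"
  have gt: "g c p = transpose ?J ** g c' p ** ?J"
    by (rule riemannian_metric_change_of_chart[OF g c])
  have JK: "?J ** ?K = mat 1"
    using transition_jacobian_chain[OF atlas c(2,1,2,4,3,4)] transition_jacobian_self[OF atlas c(2,4)] by simp
  have dJ: "det ?J \<noteq> 0" by (rule det_transition_jacobian_nonzero[OF atlas c])
  have "det (g c p) = (det ?J)\<^sup>2 * det (g c' p)"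
    by (simp add: gt det_mul det_transpose power2_eq_square)
  then have sq: "sqrt (det (g c p)) = \<bar>det ?J\<bar> * sqrt (det (g c' p))"
    by (simp add: real_sqrt_mult)
  let ?y = "flux g u c p"
  have "g c' p *v (?J *v ?y) = transpose ?K *v (g c p *v ?y)"
  proof -
    have "transpose ?K ** transpose ?J = mat 1"
      using JK by (metis matrix_transpose_mul transpose_mat)
    then show ?thesis
      by (simp add: gt matrix_vector_mul_assoc matrix_mul_assoc)
  qed
  also have "\<dots> = sqrt (det (g c p)) *\<^sub>R (transpose ?K *v differential u c p)"
    by (simp add: metric_mult_flux[OF g c(1,3)] matrix_vector_mult_scaleR)
  also have "transpose ?K *v differential u c p = differential u c' p"
    by (rule differential_change_of_chart[OF atlas c(2,1,4,3) u, symmetric])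
  also have "sqrt (det (g c p)) *\<^sub>R differential u c' p = g c' p *v (\<bar>det ?J\<bar> *\<^sub>R flux g u c' p)"
    by (simp add: sq matrix_vector_mult_scaleR metric_mult_flux[OF g c(2,4)])
  finally have "g c' p *v (?J *v ?y) = g c' p *v (\<bar>det ?J\<bar> *\<^sub>R flux g u c' p)" .
  then have J: "?J *v ?y = \<bar>det ?J\<bar> *\<^sub>R flux g u c' p"
    using riemannian_metric_det_pos[OF g c(2,4)]
    by (metis inj_matrix_vector_mult invertible_det_nz injD less_irrefl)
  have "det ?J *\<^sub>R rot90 ?y = \<bar>det ?J\<bar> *\<^sub>R (transpose ?J *v rot90 (flux g u c' p))"
    using transpose_mult_rot90[of ?J ?y] unfolding J by (simp add: rot90_scaleR matrix_vector_mult_scaleR)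
  then have "inverse (det ?J) *\<^sub>R (det ?J *\<^sub>R rot90 ?y) =
      inverse (det ?J) *\<^sub>R (\<bar>det ?J\<bar> *\<^sub>R (transpose ?J *v rot90 (flux g u c' p)))"
    by (rule arg_cong)
  moreover have "inverse (det ?J) * \<bar>det ?J\<bar> = sgn (det ?J)"
    using dJ by (simp add: sgn_if)
  ultimately show ?thesis using dJ by (simp only: scaleR_scaleR) simp
qed

lemma flux_in_coords:
  assumes "x \<in> chart_img c"
  shows "in_coords c (flux g u c) x $ i = sqrt (det (in_coords c (g c) x)) *
    (\<Sum>j\<in>UNIV. matrix_inv (in_coords c (g c) x) $ i $ j * partial_deriv j (in_coords c u) x)"
  by (simp add: flux_def in_coords_def[of c "flux g u c"] in_coords_def[of c "g c"] matrix_vector_mult_def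
      differential_def chart_map_chart_inv[OF assms])

lemma Ck_on_flux:
  fixes A :: "('a, 2) chart set"
  assumes atlas: "smooth_atlas M A" and g: "riemannian_metric A g" and u: "Ck_function (Suc k) A u" and c: "c \<in> A"
  shows "Ck_on k (in_coords c (flux g u c)) (chart_img c)"
proof -
  let ?G = "in_coords c (g c)" and ?S = "chart_img c"
  note S = open_chart_img[OF smooth_atlas_is_chart[OF atlas c]]
  have det: "det (?G x) > 0" if "x \<in> ?S" for x
    using riemannian_metric_det_pos[OF g c chart_inv_in_dom[OF that]] by (simp add: in_coords_def)
  have "Ck_on k ?G ?S"
    using g c by (simp add: riemannian_metric_def smooth_on_def)
  then have G: "Ck_on k (\<lambda>x. ?G x $ i $ j) ?S" for i j
    by (intro Ck_on_nth S)
  have dG: "Ck_on k (\<lambda>x. det (?G x)) ?S"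
    unfolding det_2 by (intro Ck_on_diff Ck_on_mult S G)
  have det0: "det (?G x) \<noteq> 0" if "x \<in> ?S" for x using det[OF that] by simp
  have inv: "Ck_on k (\<lambda>x. ?G x $ i $ j * inverse (det (?G x))) ?S" for i j
    by (intro Ck_on_mult Ck_on_inverse S dG G det0)
  have inv': "Ck_on k (\<lambda>x. - ?G x $ i $ j * inverse (det (?G x))) ?S" for i j
    by (intro Ck_on_mult Ck_on_inverse S dG det0 G
        Ck_on_bounded_linear[OF bounded_linear_minus[OF bounded_linear_ident]])
  have "Ck_on k (\<lambda>x. matrix_inv (?G x) $ 1 $ 1) ?S"
    by (rule Ck_on_cong[OF S inv matrix_inv_2(1)[OF det0, symmetric]])
  moreover have "Ck_on k (\<lambda>x. matrix_inv (?G x) $ 1 $ 2) ?S"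
    by (rule Ck_on_cong[OF S inv' matrix_inv_2(2)[OF det0, symmetric]])
  moreover have "Ck_on k (\<lambda>x. matrix_inv (?G x) $ 2 $ 1) ?S"
    by (rule Ck_on_cong[OF S inv' matrix_inv_2(3)[OF det0, symmetric]])
  moreover have "Ck_on k (\<lambda>x. matrix_inv (?G x) $ 2 $ 2) ?S"
    by (rule Ck_on_cong[OF S inv matrix_inv_2(4)[OF det0, symmetric]])
  ultimately have minv: "\<forall>i j. Ck_on k (\<lambda>x. matrix_inv (?G x) $ i $ j) ?S"
    unfolding forall_2 by blast
  have du: "Ck_on k (partial_deriv j (in_coords c u)) ?S" for j
    by (rule Ck_on_imp_partial_deriv) (use u c in \<open>simp add: Ck_function_def del: Ck_on.simps\<close>)
  show ?thesis
  proof (rule Ck_on_vec[OF S])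
    fix i
    show "Ck_on k (\<lambda>x. in_coords c (flux g u c) x $ i) ?S"
      by (rule Ck_on_cong[OF S _ flux_in_coords[symmetric]])
        (intro Ck_on_mult Ck_on_sum Ck_on_sqrt S dG det du minv[rule_format])
  qed
qed

text \<open>The eigenvalue equation in divergence form.\<close>

lemma eigenspace_divergence_flux:
  fixes A :: "('a, 2) chart set"
  assumes atlas: "smooth_atlas M A" and g: "riemannian_metric A g" and u: "u \<in> eigenspace A g lam"
    and c: "c \<in> A" "p \<in> chart_dom c"
  shows "(\<Sum>i\<in>UNIV. partial_deriv i (\<lambda>x. in_coords c (flux g u c) x $ i) (chart_map c p)) =
    - lam * u p * sqrt (det (g c p))"
proof -
  note ch = smooth_atlas_is_chart[OF atlas c(1)]
  have "partial_deriv i (\<lambda>x. in_coords c (flux g u c) x $ i) (chart_map c p) =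
      partial_deriv i (\<lambda>x. sqrt (det (in_coords c (g c) x)) *
        (\<Sum>j\<in>UNIV. matrix_inv (in_coords c (g c) x) $ i $ j * partial_deriv j (in_coords c u) x)) (chart_map c p)" for i
    unfolding partial_deriv_def[of i]
    by (rule fun_cong[OF frechet_derivative_transform_on(2)[OF open_chart_img[OF ch] chart_map_in_img[OF c(2)] flux_in_coords]])
  then have "(\<Sum>i\<in>UNIV. partial_deriv i (\<lambda>x. in_coords c (flux g u c) x $ i) (chart_map c p)) =
      laplace_beltrami g c u p * sqrt (det (g c p))"
    using riemannian_metric_det_pos[OF g c] by (simp add: laplace_beltrami_def)
  moreover have "laplace_beltrami g c u p + lam * u p = 0"
    using u c unfolding eigenspace_def by blast
  then have "laplace_beltrami g c u p = - lam * u p" by (simp add: eq_neg_iff_add_eq_0)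
  ultimately show ?thesis by simp
qed

lemma differential_inner_flux:
  assumes "riemannian_metric A g" "c \<in> A" "p \<in> chart_dom c"
  shows "sqrt (det (g c p)) * (differential u c p \<bullet> flux g v c p) = flux g u c p \<bullet> (g c p *v flux g v c p)"
proof -
  have "sqrt (det (g c p)) * (differential u c p \<bullet> flux g v c p) = (g c p *v flux g u c p) \<bullet> flux g v c p"
    by (simp add: metric_mult_flux[OF assms])
  also have "\<dots> = flux g u c p \<bullet> (transpose (g c p) *v flux g v c p)"
    using dot_lmul_matrix[of "flux g u c p" "transpose (g c p)" "flux g v c p"]
    by (simp only: vector_transpose_matrix)
  finally show ?thesis by (simp only: riemannian_metric_symmetric[OF assms])
qed

text \<open>Both sides are \<open>sqrt |g|\<close> times the inner product of the two gradients.\<close>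

lemma differential_inner_flux_commute:
  assumes "riemannian_metric A g" "c \<in> A" "p \<in> chart_dom c"
  shows "differential u c p \<bullet> flux g v c p = differential v c p \<bullet> flux g u c p"
proof -
  have "sqrt (det (g c p)) * (differential u c p \<bullet> flux g v c p) =
      sqrt (det (g c p)) * (differential v c p \<bullet> flux g u c p)"
    unfolding differential_inner_flux[OF assms, of u v]
    by (simp add: metric_mult_flux[OF assms] inner_commute)
  then show ?thesis using riemannian_metric_det_pos[OF assms] by simp
qed

lemma differential_inner_flux_pos:
  assumes "riemannian_metric A g" "c \<in> A" "p \<in> chart_dom c" "differential u c p \<noteq> 0"
  shows "differential u c p \<bullet> flux g u c p > 0"
proof -
  note det = riemannian_metric_det_pos[OF assms(1-3)]
  have "flux g u c p \<noteq> 0"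
    using metric_mult_flux[OF assms(1-3), of u] assms(4) det by auto
  from riemannian_metric_positive[OF assms(1-3) this]
  have "sqrt (det (g c p)) * (differential u c p \<bullet> flux g u c p) > 0"
    by (simp only: differential_inner_flux[OF assms(1-3)])
  then show ?thesis using det by (simp add: zero_less_mult_iff)
qed

section \<open>The Green form of two eigenfunctions\<close>

text \<open>The 1-form \<open>* (u dv - v du)\<close>, up to the orientation sign of the chart.\<close>

definition green_form :: "('a, 2) metric \<Rightarrow> ('a \<Rightarrow> real) \<Rightarrow> ('a \<Rightarrow> real) \<Rightarrow> ('a, 2) covector_field"
  where "green_form g u v c p = rot90 (u p *\<^sub>R flux g v c p - v p *\<^sub>R flux g u c p)"

lemma green_form_change_of_chart:
  assumes atlas: "smooth_atlas M A" and g: "riemannian_metric A g"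
    and c: "c \<in> A" "c' \<in> A" "p \<in> chart_dom c" "p \<in> chart_dom c'"
    and u: "has_differential A u (differential u) p" and v: "has_differential A v (differential v) p"
  shows "green_form g u v c p = sgn (det (transition_jacobian c c' p)) *\<^sub>R
    (transpose (transition_jacobian c c' p) *v green_form g u v c' p)"
  unfolding green_form_def rot90_diff rot90_scaleR rot90_flux_change_of_chart[OF atlas g c u]
    rot90_flux_change_of_chart[OF atlas g c v]
  by (simp add: scaleR_diff_right matrix_vector_mult_diff_distrib matrix_vector_mult_scaleR mult.commute)

lemma eigenspace_has_differential:
  assumes "u \<in> eigenspace A g lam"
  shows "has_differential A u (differential u) p"
  by (rule Ck_function_has_differential[of "Suc 0"])
    (use assms in \<open>unfold eigenspace_def numeral_2_eq_2, blast\<close>)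

text \<open>The vector \<open>u flux v - v flux u\<close> has divergence 0: the terms with two gradients cancel by the
symmetry of the metric, the terms with the Laplacians because the eigenvalues are the same. This is
Green's identity, and it makes the Green form closed in each chart.\<close>

lemma green_form_local_primitive:
  fixes A :: "('a, 2) chart set"
  assumes atlas: "smooth_atlas M A" and g: "riemannian_metric A g"
    and u: "u \<in> eigenspace A g lam" and v: "v \<in> eigenspace A g lam"
    and c: "c \<in> A" and S: "convex S" "open S" "S \<subseteq> chart_img c"
  shows "\<exists>\<phi>. \<forall>x\<in>S. GDERIV \<phi> x :> in_coords c (green_form g u v c) x"
proof -
  note ch = smooth_atlas_is_chart[OF atlas c]
  let ?U = "in_coords c u" and ?V = "in_coords c v"
  let ?FU = "in_coords c (flux g u c)" and ?FV = "in_coords c (flux g v c)"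
  have u2: "Ck_function (Suc (Suc 0)) A u" and v2: "Ck_function (Suc (Suc 0)) A v"
    using u v unfolding eigenspace_def numeral_2_eq_2 by blast+
  have FU: "Ck_on (Suc 0) ?FU (chart_img c)" and FV: "Ck_on (Suc 0) ?FV (chart_img c)"
    by (rule Ck_on_flux[OF atlas g u2 c], rule Ck_on_flux[OF atlas g v2 c])
  have U: "Ck_on (Suc 0) ?U (chart_img c)" and V: "Ck_on (Suc 0) ?V (chart_img c)"
    using u2 v2 c Ck_on_Suc_imp unfolding Ck_function_def by blast+
  \<comment> \<open>The trace of the derivative of this vector field is its divergence.\<close>
  define Y where "Y x = ?U x *\<^sub>R ?FV x - ?V x *\<^sub>R ?FU x" for x
  have Y: "Ck_on (Suc 0) Y (chart_img c)"
    unfolding Y_def by (intro Ck_on_diff Ck_on_scaleR open_chart_img[OF ch] FU FV U V)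
  let ?D = "\<lambda>x. frechet_derivative Y (at x)"
  have trace: "(\<Sum>i\<in>UNIV. ?D x (axis i 1) $ i) = 0" if x: "x \<in> chart_img c" for x
  proof -
    let ?p = "chart_inv c x"
    have p: "?p \<in> chart_dom c" "chart_map c ?p = x"
      using x by (auto simp: chart_inv_in_dom chart_map_chart_inv)
    let ?DU = "frechet_derivative ?U (at x)" and ?DV = "frechet_derivative ?V (at x)"
    let ?DFU = "frechet_derivative ?FU (at x)" and ?DFV = "frechet_derivative ?FV (at x)"
    have "(Y has_derivative (\<lambda>h. (?U x *\<^sub>R ?DFV h + ?DU h *\<^sub>R ?FV x) - (?V x *\<^sub>R ?DFU h + ?DV h *\<^sub>R ?FU x))) (at x)"
      unfolding Y_def
      by (intro has_derivative_diff has_derivative_scaleR Ck_on_SucD[OF U x] Ck_on_SucD[OF V x]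
          Ck_on_SucD[OF FU x] Ck_on_SucD[OF FV x])
    from frechet_derivative_at[OF this]
    have D: "?D x = (\<lambda>h. (?U x *\<^sub>R ?DFV h + ?DU h *\<^sub>R ?FV x) - (?V x *\<^sub>R ?DFU h + ?DV h *\<^sub>R ?FU x))"
      by (rule sym)
    have divU: "(\<Sum>i\<in>UNIV. ?DFU (axis i 1) $ i) = - lam * u ?p * sqrt (det (g c ?p))"
      using eigenspace_divergence_flux[OF atlas g u c p(1)]
      unfolding p(2) partial_deriv_nth[OF Ck_on_SucD[OF FU x]] .
    have divV: "(\<Sum>i\<in>UNIV. ?DFV (axis i 1) $ i) = - lam * v ?p * sqrt (det (g c ?p))"
      using eigenspace_divergence_flux[OF atlas g v c p(1)]
      unfolding p(2) partial_deriv_nth[OF Ck_on_SucD[OF FV x]] .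
    have dU: "?DU (axis i 1) = differential u c ?p $ i" and dV: "?DV (axis i 1) = differential v c ?p $ i" for i
      by (simp_all add: differential_def partial_deriv_def p(2))
    have "(\<Sum>i\<in>UNIV. ?D x (axis i 1) $ i) =
        u ?p * (\<Sum>i\<in>UNIV. ?DFV (axis i 1) $ i) + differential u c ?p \<bullet> flux g v c ?p -
        (v ?p * (\<Sum>i\<in>UNIV. ?DFU (axis i 1) $ i) + differential v c ?p \<bullet> flux g u c ?p)"
      unfolding D dU dV
      by (simp add: sum_subtractf sum.distrib sum_distrib_left inner_vec_def in_coords_def)
    then show ?thesis
      unfolding divU divV differential_inner_flux_commute[OF g c p(1), of u v] by simp
  qed
  have "\<exists>\<phi>. \<forall>x\<in>S. GDERIV \<phi> x :> rot90 (Y x)"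
  proof (rule symmetric_derivative_imp_gradient[OF S(1,2)])
    fix x assume "x \<in> S"
    then have x: "x \<in> chart_img c" using S(3) by auto
    show "((\<lambda>x. rot90 (Y x)) has_derivative (\<lambda>h. rot90 (?D x h))) (at x)"
      by (rule bounded_linear.has_derivative[OF bounded_linear_rot90 Ck_on_SucD[OF Y x]])
    show "rot90 (?D x h) \<bullet> k = rot90 (?D x k) \<bullet> h" for h k
      by (rule trace_zero_imp_rot90_symmetric[OF has_derivative_linear[OF Ck_on_SucD[OF Y x]] trace[OF x]])
  next
    fix h
    show "continuous_on S (\<lambda>x. rot90 (?D x h))"
      by (rule continuous_on_subset[OF bounded_linear.continuous_on[OF bounded_linear_rot90
            continuous_on_frechet_derivative[OF Y]] S(3)])
  qed
  moreover have "rot90 (Y x) = in_coords c (green_form g u v c) x" for x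
    by (simp add: Y_def green_form_def in_coords_def)
  ultimately show ?thesis by simp
qed

text \<open>The orientation signs turn the Green form, which is well defined only up to sign, into a covector
field on the surface. It has a local primitive near each point because the sign of a chart is locally constant.\<close>

lemma oriented_green_form_exact:
  fixes A :: "('a, 2) chart set"
  assumes M: "smooth_manifold M A" and "compact_space M" "orientable M A" "riemannian_metric A g" "H1_vanishes A"
    and u: "u \<in> eigenspace A g lam" and v: "v \<in> eigenspace A g lam"
  shows "\<exists>F \<sigma>. (\<forall>p\<in>topspace M. has_differential A F (\<lambda>c q. \<sigma> c q *\<^sub>R green_form g u v c q) p) \<and>
    (\<forall>c\<in>A. \<forall>p\<in>chart_dom c. \<sigma> c p \<in> {1, -1})"
proof -
  have atlas: "smooth_atlas M A" using M by (simp add: smooth_manifold_def)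
  note ch = smooth_atlas_is_chart[OF atlas]
  obtain \<sigma> where \<sigma>: "\<And>c p. c \<in> A \<Longrightarrow> p \<in> chart_dom c \<Longrightarrow> \<sigma> c p \<in> {1, -1::real}"
    and \<sigma>_const: "\<And>c p. c \<in> A \<Longrightarrow> p \<in> chart_dom c \<Longrightarrow>
      \<exists>W. openin M W \<and> p \<in> W \<and> W \<subseteq> chart_dom c \<and> (\<forall>q\<in>W. \<sigma> c q = \<sigma> c p)"
    and \<sigma>_sgn: "\<And>c c' p. c \<in> A \<Longrightarrow> c' \<in> A \<Longrightarrow> p \<in> chart_dom c \<Longrightarrow> p \<in> chart_dom c' \<Longrightarrow>
      sgn (det (transition_jacobian c c' p)) = \<sigma> c p * \<sigma> c' p"
    by (rule orientable_imp_orientation_signs[OF atlas assms(3)]) blast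
  define \<eta> where "\<eta> c q = \<sigma> c q *\<^sub>R green_form g u v c q" for c q
  note du = eigenspace_has_differential[OF u] and dv = eigenspace_has_differential[OF v]
  have \<eta>_change: "\<eta> c p = transpose (transition_jacobian c c' p) *v \<eta> c' p"
    if c: "c \<in> A" "c' \<in> A" "p \<in> chart_dom c" "p \<in> chart_dom c'" for c c' p
  proof -
    have "\<eta> c p = (\<sigma> c p * (\<sigma> c p * \<sigma> c' p)) *\<^sub>R
        (transpose (transition_jacobian c c' p) *v green_form g u v c' p)"
      unfolding \<eta>_def green_form_change_of_chart[OF atlas assms(4) c du dv] \<sigma>_sgn[OF c]
      by (simp only: scaleR_scaleR)
    also have "\<sigma> c p * (\<sigma> c p * \<sigma> c' p) = \<sigma> c' p" using \<sigma>[OF c(1,3)] by auto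
    finally show ?thesis by (simp only: \<eta>_def matrix_vector_mult_scaleR)
  qed
  have "\<exists>U \<phi>. openin M U \<and> p \<in> U \<and> (\<forall>q\<in>U. has_differential A \<phi> \<eta> q)" if p: "p \<in> topspace M" for p
  proof -
    obtain c where c: "c \<in> A" "p \<in> chart_dom c" using p smooth_atlas_topspace[OF atlas] by auto
    from \<sigma>_const[OF c] obtain W where W: "openin M W" "p \<in> W" "\<forall>q\<in>W. \<sigma> c q = \<sigma> c p" by blast
    let ?x0 = "chart_map c p"
    let ?T = "chart_map c ` (chart_dom c \<inter> W)"
    have "open ?T" "?x0 \<in> ?T" using open_chart_image[OF ch[OF c(1)] W(1)] c(2) W(2) by auto
    then obtain r where r: "r > 0" "ball ?x0 r \<subseteq> ?T" by (meson open_contains_ball)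
    have "ball ?x0 r \<subseteq> chart_img c" using r(2) unfolding chart_img_def by blast
    from green_form_local_primitive[OF atlas assms(4) u v c(1) convex_ball open_ball this]
    obtain f where f: "\<forall>x\<in>ball ?x0 r. GDERIV f x :> in_coords c (green_form g u v c) x" ..
    define \<phi> where "\<phi> q = \<sigma> c p * f (chart_map c q)" for q
    let ?U = "{q \<in> chart_dom c. chart_map c q \<in> ball ?x0 r}"
    have "has_differential A \<phi> \<eta> q" if q: "q \<in> ?U" for q
    proof (rule has_differential_if_in_chart[OF atlas c(1)])
      show qc: "q \<in> chart_dom c" using q by blast
      let ?y = "chart_map c q"
      have y: "?y \<in> ball ?x0 r" using q by blast
      obtain q' where q': "q' \<in> chart_dom c" "q' \<in> W" "?y = chart_map c q'" using subsetD[OF r(2) y] by blast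
      then have "q = q'" using is_chart_inj_on[OF ch[OF c(1)]] qc by (simp add: inj_on_eq_iff)
      then have s: "\<sigma> c q = \<sigma> c p" using W(3) q'(2) by blast
      have "GDERIV f ?y :> green_form g u v c q"
        using bspec[OF f y] by (simp only: in_coords_chart_map[OF ch[OF c(1)] qc])
      then have "GDERIV (\<lambda>x. \<sigma> c p * f x) ?y :> \<sigma> c p *\<^sub>R green_form g u v c q"
        using GDERIV_mult[OF GDERIV_const[of "\<sigma> c p" ?y]] by fastforce
      then have "GDERIV (in_coords c \<phi>) ?y :> \<sigma> c p *\<^sub>R green_form g u v c q"
      proof (rule GDERIV_transform_open[OF _ open_chart_img[OF ch[OF c(1)]] chart_map_in_img[OF qc]])
        fix x assume "x \<in> chart_img c"
        then show "\<sigma> c p * f x = in_coords c \<phi> x" by (simp add: in_coords_def \<phi>_def chart_map_chart_inv)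
      qed
      then show "GDERIV (in_coords c \<phi>) ?y :> \<eta> c q" by (simp only: \<eta>_def s)
      show "\<eta> c' q = transpose (transition_jacobian c' c q) *v \<eta> c q" if "c' \<in> A" "q \<in> chart_dom c'" for c'
        by (rule \<eta>_change[OF that(1) c(1) that(2) qc])
    qed
    moreover have "openin M ?U" by (rule openin_chart_vimage[OF ch[OF c(1)] open_ball])
    moreover have "p \<in> ?U" using c(2) r(1) by simp
    ultimately show ?thesis by (intro exI[of _ ?U] exI[of _ \<phi>]) simp
  qed
  from locally_exact_imp_exact[OF M assms(2,5) this]
  obtain F where "\<forall>p\<in>topspace M. has_differential A F \<eta> p" ..
  then have "\<forall>p\<in>topspace M. has_differential A F (\<lambda>c q. \<sigma> c q *\<^sub>R green_form g u v c q) p"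
    by (simp only: \<eta>_def[abs_def])
  with \<sigma> show ?thesis by (intro exI[of _ F] exI[of _ \<sigma>]) blast
qed

section \<open>Zeros of an eigenfunction on a nodal component\<close>

text \<open>The implicit function theorem in the plane. Completing \<open>f\<close> by the coordinate in the direction of the quarter
turn of the gradient \<open>D\<close> gives a map \<open>G\<close> that is invertible near \<open>x0\<close>; the curve is the image under its
inverse of a segment, scaled so that its velocity at 0 is exactly the quarter turn of \<open>D\<close>.\<close>

lemma level_curve:
  fixes f :: "real^2 \<Rightarrow> real"
  assumes "open S" "x0 \<in> S" and f: "Ck_on (Suc 0) f S" and "f x0 = 0"
    and D: "GDERIV f x0 :> D" "D \<noteq> 0"
  obtains \<gamma> :: "real \<Rightarrow> real^2" and \<delta> where "\<delta> > 0" "\<gamma> 0 = x0" "continuous_on {-\<delta><..<\<delta>} \<gamma>"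
    "inj_on \<gamma> {-\<delta><..<\<delta>}" "\<And>s. s \<in> {-\<delta><..<\<delta>} \<Longrightarrow> \<gamma> s \<in> S \<and> f (\<gamma> s) = 0"
    "(\<gamma> has_derivative (\<lambda>s. s *\<^sub>R rot90 D)) (at 0)"
proof -
  define n where "n = D \<bullet> D"
  have n: "n > 0" using D(2) by (simp add: n_def)
  define gr where "gr x = (\<chi> i. partial_deriv i f x)" for x
  have gr: "GDERIV f x :> gr x" if "x \<in> S" for x
    unfolding gr_def by (rule Ck_on_imp_GDERIV[OF f that])
  have gr0: "gr x0 = D"
    using GDERIV_imp_partial_deriv[OF D(1)] by (simp add: gr_def vec_eq_iff)
  have cont_gr: "continuous_on S gr"
    unfolding gr_def
    by (intro continuous_intros) (use Ck_on_imp_partial_deriv[OF f] in simp)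
  \<comment> \<open>At \<open>x0\<close> the derivative of this map is \<open>n\<close> times the identity.\<close>
  define G where "G x = f x *\<^sub>R D + ((x - x0) \<bullet> rot90 D) *\<^sub>R rot90 D" for x
  define G' where "G' x h = (h \<bullet> gr x) *\<^sub>R D + (h \<bullet> rot90 D) *\<^sub>R rot90 D" for x h
  have G'_lin: "bounded_linear (G' x)" for x
    unfolding G'_def
    by (intro bounded_linear_add bounded_linear_scaleR_const bounded_linear_inner_left)
  have G'0: "G' x0 h = n *\<^sub>R h" for h
    by (simp add: G'_def gr0 n_def vec_eq_iff forall_2 inner_real_2 algebra_simps)
  define B where "B x = Blinfun (G' x)" for x
  have B: "blinfun_apply (B x) = G' x" for x
    unfolding B_def by (rule bounded_linear_Blinfun_apply[OF G'_lin])
  have derG: "(G has_derivative blinfun_apply (B x)) (at x)" if "x \<in> S" for x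
  proof -
    have "(f has_derivative (\<lambda>h. h \<bullet> gr x)) (at x)" using gr[OF that] by (simp add: gderiv_def)
    then have "(G has_derivative (\<lambda>h. (h \<bullet> gr x) *\<^sub>R D + ((h - 0) \<bullet> rot90 D) *\<^sub>R rot90 D)) (at x)"
      unfolding G_def
      by (intro has_derivative_add has_derivative_scaleR_left has_derivative_inner_left
          has_derivative_diff has_derivative_ident has_derivative_const)
    then show ?thesis unfolding B G'_def by simp
  qed
  have contB: "continuous_on S B"
  proof (rule continuous_on_blinfun_componentwise)
    show "continuous_on S (\<lambda>x. blinfun_apply (B x) h)" for h
      unfolding B G'_def by (intro continuous_intros cont_gr)
  qed
  define I where "I = Blinfun (\<lambda>h::real^2. h /\<^sub>R n)"
  have I: "blinfun_apply I h = h /\<^sub>R n" for h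
    unfolding I_def by (subst bounded_linear_Blinfun_apply[OF bounded_linear_scaleR_right]) simp
  have "I o\<^sub>L B x0 = id_blinfun"
    by (rule blinfun_eqI) (simp add: I B G'0 n less_imp_neq[symmetric])
  from inverse_function_theorem[OF assms(1) derG contB assms(2) this]
  obtain U V g g' where U: "U \<subseteq> S" "x0 \<in> U" and V: "open V" "G x0 \<in> V" and hom: "homeomorphism U V G g"
    and g': "\<And>y. y \<in> V \<Longrightarrow> (g has_derivative (g' y)) (at y)"
      "\<And>y. y \<in> V \<Longrightarrow> g' y = inv (blinfun_apply (B (g y)))" by metis
  have G0: "G x0 = 0" by (simp add: G_def assms(4))
  have g0: "g 0 = x0" using homeomorphism_apply1[OF hom U(2)] G0 by simp
  have V0: "0 \<in> V" using V(2) G0 by simp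
  have dg: "(g has_derivative (\<lambda>h. h /\<^sub>R n)) (at 0)"
  proof -
    have "inv (blinfun_apply (B (g 0))) = (\<lambda>h. h /\<^sub>R n)"
      unfolding g0 B by (rule inv_unique_comp) (use n in \<open>auto simp: fun_eq_iff G'0\<close>)
    then show ?thesis using g'[OF V0] by simp
  qed
  define l where "l s = (s * n) *\<^sub>R rot90 D" for s :: real
  define \<gamma> where "\<gamma> s = g (l s)" for s
  obtain e where e: "e > 0" "ball 0 e \<subseteq> V" using V(1) V0 open_contains_ball by blast
  have rotD: "rot90 D \<noteq> 0" using D(2) rot90_inner_rot90[of D D] by auto
  define \<delta> where "\<delta> = e / (n * norm (rot90 D))"
  have \<delta>: "\<delta> > 0" using e n rotD by (simp add: \<delta>_def)
  have l: "l s \<in> V" if "s \<in> {-\<delta><..<\<delta>}" for s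
  proof -
    have "\<bar>s\<bar> < \<delta>" using that by auto
    then have "\<bar>s\<bar> * (n * norm (rot90 D)) < e" using n rotD by (simp add: \<delta>_def pos_less_divide_eq)
    then have "norm (l s) < e" using n by (simp add: l_def abs_mult mult.assoc)
    then show ?thesis using e(2) by auto
  qed
  have contg: "continuous_on V g" using hom by (simp add: homeomorphism_def)
  show ?thesis
  proof (rule that[OF \<delta>])
    show "\<gamma> 0 = x0" by (simp add: \<gamma>_def l_def g0)
    have "continuous_on {-\<delta><..<\<delta>} l" unfolding l_def by (intro continuous_intros)
    then show "continuous_on {-\<delta><..<\<delta>} \<gamma>"
      unfolding \<gamma>_def by (rule continuous_on_compose2[OF contg]) (use l in blast)
    have Gg: "G (\<gamma> s) = l s" if "s \<in> {-\<delta><..<\<delta>}" for s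
      unfolding \<gamma>_def by (rule homeomorphism_apply2[OF hom l[OF that]])
    show "inj_on \<gamma> {-\<delta><..<\<delta>}"
    proof (rule inj_onI)
      fix s t assume st: "s \<in> {-\<delta><..<\<delta>}" "t \<in> {-\<delta><..<\<delta>}" "\<gamma> s = \<gamma> t"
      then have "l s = l t" using Gg[OF st(1)] Gg[OF st(2)] by simp
      then show "s = t" using n rotD by (simp add: l_def)
    qed
    show "\<gamma> s \<in> S \<and> f (\<gamma> s) = 0" if s: "s \<in> {-\<delta><..<\<delta>}" for s
    proof
      have "g ` V = U" using hom by (simp add: homeomorphism_def)
      then show "\<gamma> s \<in> S" using U(1) l[OF s] unfolding \<gamma>_def by blast
      have "G (\<gamma> s) \<bullet> D = l s \<bullet> D" by (simp only: Gg[OF s])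
      then have "f (\<gamma> s) * n = 0"
        by (simp add: G_def l_def inner_add_left rot90_inner_self n_def)
      then show "f (\<gamma> s) = 0" using n by simp
    qed
    have dl: "(l has_derivative (\<lambda>s. (s * n) *\<^sub>R rot90 D)) (at 0)"
      unfolding l_def by (auto intro!: derivative_eq_intros)
    have "(g has_derivative (\<lambda>h. h /\<^sub>R n)) (at (l 0))" using dg by (simp add: l_def)
    from has_derivative_compose[OF dl this]
    have "(\<gamma> has_derivative (\<lambda>s. ((s * n) *\<^sub>R rot90 D) /\<^sub>R n)) (at 0)"
      unfolding \<gamma>_def .
    then show "(\<gamma> has_derivative (\<lambda>s. s *\<^sub>R rot90 D)) (at 0)"
      by (rule has_derivative_eq_rhs) (use n in \<open>simp add: fun_eq_iff\<close>)
  qed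
qed

text \<open>The level curve of \<open>u\<close> in a chart is connected and lies in the nodal set, so it stays in the
component of its starting point. By injectivity the component has more than one point.\<close>

lemma nodal_curve:
  fixes A :: "('a, 2) chart set"
  assumes atlas: "smooth_atlas M A" and u: "Ck_function (Suc 0) A u"
    and C: "C \<in> connected_components_of (subtopology M (nodal_set M u))"
    and p: "p \<in> C" and c: "c \<in> A" "p \<in> chart_dom c" and du: "differential u c p \<noteq> 0"
  shows "\<exists>(\<gamma> :: real \<Rightarrow> real^2) \<delta>. \<delta> > 0 \<and> \<gamma> 0 = chart_map c p \<and>
    (\<forall>s\<in>{-\<delta><..<\<delta>}. \<gamma> s \<in> chart_img c \<and> chart_inv c (\<gamma> s) \<in> C) \<and>
    inj_on \<gamma> {-\<delta><..<\<delta>} \<and> (\<gamma> has_derivative (\<lambda>s. s *\<^sub>R rot90 (differential u c p))) (at 0)"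
proof -
  note ch = smooth_atlas_is_chart[OF atlas c(1)]
  let ?N = "nodal_set M u"
  have NM: "?N \<subseteq> topspace M" by (auto simp: nodal_set_def)
  have "C \<subseteq> ?N" using connected_components_of_subset[OF C] by simp
  then have "u p = 0" using p by (auto simp: nodal_set_def)
  then have 0: "in_coords c u (chart_map c p) = 0" by (simp only: in_coords_chart_map[OF ch c(2)])
  have cu: "Ck_on (Suc 0) (in_coords c u) (chart_img c)" using u c(1) unfolding Ck_function_def by blast
  have du': "GDERIV (in_coords c u) (chart_map c p) :> differential u c p"
    using Ck_function_has_differential[OF u] c unfolding has_differential_def by blast
  obtain \<gamma> \<delta> where \<gamma>: "\<delta> > 0" "\<gamma> 0 = chart_map c p" "continuous_on {-\<delta><..<\<delta>} \<gamma>"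
    "inj_on \<gamma> {-\<delta><..<\<delta>}" "\<And>s. s \<in> {-\<delta><..<\<delta>} \<Longrightarrow> \<gamma> s \<in> chart_img c \<and> in_coords c u (\<gamma> s) = 0"
    "(\<gamma> has_derivative (\<lambda>s. s *\<^sub>R rot90 (differential u c p))) (at 0)"
    using level_curve[OF open_chart_img[OF ch] chart_map_in_img[OF c(2)] cu 0 du' du] by blast
  let ?I = "{-\<delta><..<\<delta>}"
  let ?\<Gamma> = "\<lambda>s. chart_inv c (\<gamma> s)"
  have "continuous_map (top_of_set ?I) (top_of_set (chart_img c)) \<gamma>"
    using \<gamma>(3,5) by (auto simp: continuous_map_in_subtopology)
  from continuous_map_compose[OF this continuous_map_chart_inv[OF ch]]
  have "continuous_map (top_of_set ?I) M ?\<Gamma>" by (simp add: o_def)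
  moreover have N: "?\<Gamma> ` ?I \<subseteq> ?N"
  proof
    fix q assume "q \<in> ?\<Gamma> ` ?I"
    then obtain s where s: "s \<in> ?I" "q = ?\<Gamma> s" by blast
    then have "q \<in> chart_dom c" "u q = 0"
      using \<gamma>(5)[OF s(1)] chart_inv_in_dom[of "\<gamma> s" c] by (simp_all add: in_coords_def)
    then show "q \<in> ?N" using smooth_atlas_topspace[OF atlas] c(1) by (auto simp: nodal_set_def)
  qed
  ultimately have "continuous_map (top_of_set ?I) (subtopology M ?N) ?\<Gamma>"
    by (auto simp: continuous_map_in_subtopology)
  moreover have "connectedin (top_of_set ?I) ?I"
    by (simp add: connectedin_subtopology)
  ultimately have "connectedin (subtopology M ?N) (?\<Gamma> ` ?I)"
    by (rule connectedin_continuous_map_image)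
  moreover have "p \<in> ?\<Gamma> ` ?I"
    using \<gamma>(1,2) chart_inv_chart_map[OF ch c(2)] by (intro image_eqI[of _ _ 0]) auto
  then have "\<not> disjnt C (?\<Gamma> ` ?I)" using p by (auto simp: disjnt_def)
  ultimately have "?\<Gamma> ` ?I \<subseteq> C" by (rule connected_components_of_maximal[OF C])
  with \<gamma> show ?thesis by (intro exI[of _ \<gamma>] exI[of _ \<delta>]) auto
qed

text \<open>Restricted to the nodal curve through \<open>p\<close>, the function \<open>F\<close> has a local extremum at \<open>p\<close>. Its
derivative there is the value of the Green form on the tangent vector of the curve. Since \<open>u p = 0\<close>,
this value is \<open>- v p\<close> times \<open>\<sigma> c p\<close> and the positive number
\<open>du \<bullet> flux u\<close>.\<close>

lemma extremum_on_nodal_component_imp_zero: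
  fixes A :: "('a, 2) chart set"
  assumes atlas: "smooth_atlas M A" and g: "riemannian_metric A g"
    and u: "Ck_function (Suc 0) A u"
    and C: "C \<in> connected_components_of (subtopology M (nodal_set M u))"
    and p: "p \<in> C" and c: "c \<in> A" "p \<in> chart_dom c" and du: "differential u c p \<noteq> 0"
    and F: "has_differential A F (\<lambda>c q. \<sigma> c q *\<^sub>R green_form g u v c q) p" and \<sigma>: "\<sigma> c p \<noteq> 0"
    and ext: "(\<forall>q\<in>C. F q \<le> F p) \<or> (\<forall>q\<in>C. F p \<le> F q)"
  shows "v p = 0"
proof -
  note ch = smooth_atlas_is_chart[OF atlas c(1)]
  let ?D = "differential u c p"
  obtain \<gamma> :: "real \<Rightarrow> real^2" and \<delta> where d\<gamma>: "(\<gamma> has_derivative (\<lambda>s. s *\<^sub>R rot90 ?D)) (at 0)"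
    and \<gamma>: "\<delta> > 0" "\<gamma> 0 = chart_map c p"
    "\<forall>s\<in>{-\<delta><..<\<delta>}. \<gamma> s \<in> chart_img c \<and> chart_inv c (\<gamma> s) \<in> C"
    using nodal_curve[OF atlas u C p c du] by (elim exE conjE)
  let ?f = "\<lambda>s. in_coords c F (\<gamma> s)"
  have "(in_coords c F has_derivative (\<lambda>h. h \<bullet> (\<sigma> c p *\<^sub>R green_form g u v c p))) (at (\<gamma> 0))"
    using F[unfolded has_differential_def, rule_format, OF c] by (simp only: gderiv_def \<gamma>(2))
  from has_derivative_compose[OF d\<gamma> this]
  have "(?f has_derivative (\<lambda>s. (rot90 ?D \<bullet> (\<sigma> c p *\<^sub>R green_form g u v c p)) * s)) (at 0)"
    by (rule has_derivative_eq_rhs) (simp add: fun_eq_iff mult_ac)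
  then have der: "(?f has_real_derivative (rot90 ?D \<bullet> (\<sigma> c p *\<^sub>R green_form g u v c p))) (at 0)"
    by (simp only: has_field_derivative_def)
  have f0: "?f 0 = F p" unfolding \<gamma>(2) by (rule in_coords_chart_map[OF ch c(2)])
  have fC: "\<exists>q\<in>C. ?f s = F q" if "\<bar>0 - s\<bar> < \<delta>" for s
  proof -
    have "s \<in> {-\<delta><..<\<delta>}" using that by auto
    then have "chart_inv c (\<gamma> s) \<in> C" using \<gamma>(3) by blast
    then show ?thesis by (rule rev_bexI) (simp add: in_coords_def)
  qed
  have "rot90 ?D \<bullet> (\<sigma> c p *\<^sub>R green_form g u v c p) = 0"
    using ext
  proof
    assume "\<forall>q\<in>C. F q \<le> F p"
    then have "?f s \<le> ?f 0" if "\<bar>0 - s\<bar> < \<delta>" for s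
      using fC[OF that] by (auto simp only: f0)
    then show ?thesis by (intro DERIV_local_max[OF der \<gamma>(1)] allI impI)
  next
    assume "\<forall>q\<in>C. F p \<le> F q"
    then have "?f 0 \<le> ?f s" if "\<bar>0 - s\<bar> < \<delta>" for s
      using fC[OF that] by (auto simp only: f0)
    then show ?thesis by (intro DERIV_local_min[OF der \<gamma>(1)] allI impI)
  qed
  moreover have "u p = 0"
    using connected_components_of_subset[OF C] p by (auto simp: nodal_set_def)
  then have "rot90 ?D \<bullet> (\<sigma> c p *\<^sub>R green_form g u v c p) = - \<sigma> c p * v p * (?D \<bullet> flux g u c p)"
    by (simp add: green_form_def rot90_diff rot90_scaleR inner_diff_right rot90_inner_rot90)
  ultimately show "v p = 0"
    using \<sigma> differential_inner_flux_pos[OF g c du] by simp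
qed

theorem proposition1:
  fixes M :: "'a topology"
    and A :: "('a, 2) chart set"
    and g :: "('a, 2) metric"
    and lam :: real
    and u v :: "'a \<Rightarrow> real"
    and C :: "'a set"
  assumes "smooth_manifold M A"
    and "compact_space M"
    and "connected_space M"
    and "orientable M A"
    and "riemannian_metric A g"
    and "H1_vanishes A"
    and "lam \<noteq> 0"
    and "u \<in> eigenspace A g lam"
    and "\<not> critical_value M A u 0"
    and "v \<in> eigenspace A g lam"
    and "C \<in> connected_components_of (subtopology M (nodal_set M u))"
  shows "\<exists>x\<in>C \<inter> nodal_set M v. \<exists>y\<in>C \<inter> nodal_set M v. x \<noteq> y"
proof -
  note atlas = assms(1)[unfolded smooth_manifold_def, THEN conjunct2, THEN conjunct2]
  note u = assms(8) and v = assms(10) and C = assms(11)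
  have u1: "Ck_function (Suc 0) A u"
  proof -
    have "Ck_function (Suc (Suc 0)) A u"
      using u unfolding eigenspace_def numeral_2_eq_2 by blast
    then show ?thesis using Ck_on_Suc_imp unfolding Ck_function_def by blast
  qed
  have CN: "C \<subseteq> nodal_set M u" using connected_components_of_subset[OF C] by simp
  then have CM: "C \<subseteq> topspace M" by (auto simp: nodal_set_def)
  have noncrit: "\<exists>c\<in>A. p \<in> chart_dom c \<and> differential u c p \<noteq> 0" if "p \<in> C" for p
  proof (rule ccontr)
    assume "\<not> ?thesis"
    then have "critical_point A u p" unfolding critical_point_def by blast
    moreover have "p \<in> topspace M" "u p = 0" using that CN by (auto simp: nodal_set_def)
    ultimately show False using assms(9) unfolding critical_value_def by blast
  qed
  obtain F \<sigma> where F: "\<forall>p\<in>topspace M. has_differential A F (\<lambda>c q. \<sigma> c q *\<^sub>R green_form g u v c q) p"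
    and \<sigma>: "\<forall>c\<in>A. \<forall>p\<in>chart_dom c. \<sigma> c p \<in> {1, -1}"
    using oriented_green_form_exact[OF assms(1,2,4,5,6) u v] by (elim exE conjE)
  have zero: "p \<in> C \<inter> nodal_set M v"
    if p: "p \<in> C" and ext: "(\<forall>q\<in>C. F q \<le> F p) \<or> (\<forall>q\<in>C. F p \<le> F q)" for p
  proof -
    obtain c where c: "c \<in> A" "p \<in> chart_dom c" "differential u c p \<noteq> 0" using noncrit[OF p] by blast
    have pM: "p \<in> topspace M" using p CM by blast
    have "\<sigma> c p \<noteq> 0" using bspec[OF bspec[OF \<sigma> c(1)] c(2)] by auto
    then have "v p = 0"
      by (rule extremum_on_nodal_component_imp_zero[OF atlas assms(5) u1 C p c bspec[OF F pM] _ ext])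
    with p pM show ?thesis by (simp add: nodal_set_def)
  qed
  have "continuous_map M euclideanreal u"
    by (rule has_differential_imp_continuous_map[OF atlas eigenspace_has_differential[OF u]])
  then have "closedin M {p \<in> topspace M. u p \<in> {0}}"
    by (rule closedin_continuous_map_preimage) simp
  then have "closedin M (nodal_set M u)" by (simp add: nodal_set_def)
  then have "closedin M C"
    using closedin_connected_components_of[OF C] by (simp add: closedin_closed_subtopology)
  then have "compactin M C" by (rule closedin_compact_space[OF assms(2)])
  then have "compactin euclideanreal (F ` C)"
    by (rule image_compactin) (rule has_differential_imp_continuous_map[OF atlas bspec[OF F]])
  then have K: "compact (F ` C)" by simp
  have C0: "C \<noteq> {}" by (rule nonempty_connected_components_of[OF C])
  obtain p where p: "p \<in> C" "\<forall>q\<in>C. F q \<le> F p"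
    using compact_attains_sup[OF K] C0 by blast
  obtain q where q: "q \<in> C" "\<forall>r\<in>C. F q \<le> F r"
    using compact_attains_inf[OF K] C0 by blast
  show ?thesis
  proof (cases "p = q")
    case False
    with zero[OF p(1) disjI1[OF p(2)]] zero[OF q(1) disjI2[OF q(2)]] show ?thesis by blast
  next
    case True
    \<comment> \<open>Now \<open>F\<close> is constant on \<open>C\<close>, so any second point of \<open>C\<close> is an extremum as well.\<close>
    obtain c where c: "c \<in> A" "p \<in> chart_dom c" "differential u c p \<noteq> 0" using noncrit[OF p(1)] by blast
    obtain \<gamma> :: "real \<Rightarrow> real^2" and \<delta> where "(\<gamma> has_derivative (\<lambda>s. s *\<^sub>R rot90 (differential u c p))) (at 0)"
      and \<gamma>: "\<delta> > 0" "\<gamma> 0 = chart_map c p"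
      "\<forall>s\<in>{-\<delta><..<\<delta>}. \<gamma> s \<in> chart_img c \<and> chart_inv c (\<gamma> s) \<in> C"
      "inj_on \<gamma> {-\<delta><..<\<delta>}"
      using nodal_curve[OF atlas u1 C p(1) c] by (elim exE conjE)
    have s: "\<delta> / 2 \<in> {-\<delta><..<\<delta>}" "0 \<in> {-\<delta><..<\<delta>}" using \<gamma>(1) by auto
    let ?r = "chart_inv c (\<gamma> (\<delta> / 2))"
    have r: "?r \<in> C" using bspec[OF \<gamma>(3) s(1)] by blast
    have "\<gamma> (\<delta> / 2) \<noteq> \<gamma> 0" using inj_onD[OF \<gamma>(4) _ s] \<gamma>(1) by auto
    then have "?r \<noteq> p"
      using chart_map_chart_inv[of "\<gamma> (\<delta> / 2)" c] bspec[OF \<gamma>(3) s(1)] \<gamma>(2) by auto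
    moreover have "F ?r = F p"
      by (rule order_antisym) (use p(2) q(2) r True in blast)+
    then have "\<forall>q\<in>C. F q \<le> F ?r" using p(2) by (simp only:)
    ultimately show ?thesis using zero[OF r disjI1] zero[OF p(1) disjI1[OF p(2)]] by blast
  qed
qed

end
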